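(* Let $ABC$ be a (nondegenerate) triangle in the Euclidean plane with nine-point circle $\mathsf{N}$ and incircle $\mathsf{I}$, and let $\Phi = T_1K^{-1}T_2K^{-1}$, where $K$ is the complement map of $ABC$, $T_1$ is the affine map taking $ABC$ to the triangle of contact points of $\mathsf{I}$, and $T_2$ is the affine map taking the triangle of excenters $A'B'C'$ to $ABC$ (see context). Then: 1) $\Phi$ takes $\mathsf{N}$ to $\mathsf{I}$, i.e. $\Phi(\mathsf{N})=\mathsf{I}$. 2) $\Phi$ has a fixed point $Z$ which lies on $\mathsf{N}$. 3) $\Phi$ is a homothety. 4) If $ABC$ is not equilateral, the unique fixed point (center) of $\Phi$ is the Feuerbach point $Z$, i.e. the point where the incircle $\mathsf{I}$ touches (is tangent to) the nine-point circle $\mathsf{N}$.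
   Context: An affine map of the plane is a map $X\mapsto MX+b$ with $M$ a non-singular real $2\times 2$ matrix and $b\in\mathbb{R}^2$. For two triangles there is a unique affine map taking the vertices of the first to the vertices of the second in the given order; $T(XYZ)=UVW$ means $T(X)=U$, $T(Y)=V$, $T(Z)=W$. Products of maps are compositions, with the rightmost map applied first. A homothety is a map $h$ of the plane for which there are a point $O$ (a center) and a real number $k$ with $h(O)=O$ and $\overrightarrow{Oh(P)}=k\,\overrightarrow{OP}$ for all $P\ne O$ (the identity map, $k=1$, is allowed). The nine-point circle $\mathsf{N}$ is the circle through the midpoints of the sides of $ABC$, the feet of its altitudes, and the midpoints of the segments joining the orthocenter to the vertices. The incircle $\mathsf{I}$ is the circle internally tangent to the three sides. $D,E,F$ are the points of tangency of $\mathsf{I}$ with $BC,AC,AB$, respectively. $A',B',C'$ are the centers of the three excircles of $ABC$, opposite $A,B,C$ respectively (so the excircle with center $A'$ is tangent to side $BC$ at a point between $B$ and $C$, and to the extended sides $AB$, $AC$). $K$ is the homothety with center the centroid $G$ of $ABC$ and ratio $-1/2$ (so $K$ takes each vertex to the midpoint of the opposite side). $T_1$ is the unique affine map with $T_1(ABC)=DEF$. $T_2$ is the unique affine map with $T_2(A'B'C')=ABC$. Two circles are tangent at a point if they both pass through the point and have the same tangent line there. *)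

theory Defs
  imports "HOL-Analysis.Analysis"
begin

type_synonym plane = "real^2"

definition affine_map :: "(plane \<Rightarrow> plane) \<Rightarrow> bool" where
  "affine_map f \<longleftrightarrow> (\<exists>(M :: real^2^2) b. invertible M \<and> f = (\<lambda>X. M *v X + b))"

definition triangle_map ::
  "plane \<Rightarrow> plane \<Rightarrow> plane \<Rightarrow> plane \<Rightarrow> plane \<Rightarrow> plane \<Rightarrow> plane \<Rightarrow> plane" where
  "triangle_map X Y Z U V W = (THE f. affine_map f \<and> f X = U \<and> f Y = V \<and> f Z = W)"

definition homothety_about :: "plane \<Rightarrow> real \<Rightarrow> (plane \<Rightarrow> plane) \<Rightarrow> bool" where
  "homothety_about Q k h \<longleftrightarrow> h Q = Q \<and> (\<forall>P. P \<noteq> Q \<longrightarrow> h P - Q = k *\<^sub>R (P - Q))"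

definition homothety :: "(plane \<Rightarrow> plane) \<Rightarrow> bool" where
  "homothety h \<longleftrightarrow> (\<exists>Q k. homothety_about Q k h)"

definition is_circle :: "plane set \<Rightarrow> bool" where
  "is_circle S \<longleftrightarrow> (\<exists>Q r. r > 0 \<and> S = sphere Q r)"

text \<open>\<open>l\<close> is the tangent line of the circle \<open>S\<close> at its point \<open>P\<close>: the line through \<open>P\<close>
  perpendicular to the radius.\<close>

definition tangent_at :: "plane set \<Rightarrow> plane set \<Rightarrow> plane \<Rightarrow> bool" where
  "tangent_at S l P \<longleftrightarrow>
    (\<exists>Q r. r > 0 \<and> S = sphere Q r \<and> P \<in> S \<and> l = {X. (X - P) \<bullet> (P - Q) = 0})"

definition circles_tangent_at :: "plane set \<Rightarrow> plane set \<Rightarrow> plane \<Rightarrow> bool" where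
  "circles_tangent_at S S' P \<longleftrightarrow> (\<exists>l. tangent_at S l P \<and> tangent_at S' l P)"

definition touch_point :: "plane set \<Rightarrow> plane \<Rightarrow> plane \<Rightarrow> plane" where
  "touch_point S X Y = (THE P. tangent_at S (affine hull {X, Y}) P)"

text \<open>Tangency to a side, as opposed to its extension, means that the point of tangency lies
  strictly between the two vertices. This singles out the incircle among the four circles
  tangent to the three side lines, and each excircle through its one side touched internally.\<close>

definition touches_side :: "plane set \<Rightarrow> plane \<Rightarrow> plane \<Rightarrow> bool" where
  "touches_side S X Y \<longleftrightarrow> (\<exists>P \<in> open_segment X Y. tangent_at S (affine hull {X, Y}) P)"

definition touches_extension :: "plane set \<Rightarrow> plane \<Rightarrow> plane \<Rightarrow> bool" where
  "touches_extension S X Y \<longleftrightarrow>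
    (\<exists>P \<in> affine hull {X, Y} - closed_segment X Y. tangent_at S (affine hull {X, Y}) P)"

definition incircle :: "plane \<Rightarrow> plane \<Rightarrow> plane \<Rightarrow> plane set" where
  "incircle A B C =
    (THE S. is_circle S \<and> touches_side S B C \<and> touches_side S A C \<and> touches_side S A B)"

text \<open>The center of the excircle opposite the first argument.\<close>

definition excenter :: "plane \<Rightarrow> plane \<Rightarrow> plane \<Rightarrow> plane" where
  "excenter A B C = (THE Q. \<exists>r > 0. touches_side (sphere Q r) B C \<and>
     touches_extension (sphere Q r) A B \<and> touches_extension (sphere Q r) A C)"

text \<open>The foot of the altitude from the first argument.\<close>

definition altitude_foot :: "plane \<Rightarrow> plane \<Rightarrow> plane \<Rightarrow> plane" where
  "altitude_foot A B C = (THE P. P \<in> affine hull {B, C} \<and> (P - A) \<bullet> (C - B) = 0)"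

definition orthocenter :: "plane \<Rightarrow> plane \<Rightarrow> plane \<Rightarrow> plane" where
  "orthocenter A B C =
    (THE H. (H - A) \<bullet> (C - B) = 0 \<and> (H - B) \<bullet> (A - C) = 0 \<and> (H - C) \<bullet> (B - A) = 0)"

definition nine_point_circle :: "plane \<Rightarrow> plane \<Rightarrow> plane \<Rightarrow> plane set" where
  "nine_point_circle A B C = (THE S. is_circle S \<and>
     {midpoint B C, midpoint A C, midpoint A B} \<subseteq> S \<and>
     {altitude_foot A B C, altitude_foot B A C, altitude_foot C A B} \<subseteq> S \<and>
     {midpoint (orthocenter A B C) A, midpoint (orthocenter A B C) B,
      midpoint (orthocenter A B C) C} \<subseteq> S)"

definition centroid :: "plane \<Rightarrow> plane \<Rightarrow> plane \<Rightarrow> plane" where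
  "centroid A B C = (1/3) *\<^sub>R (A + B + C)"

definition complement_map :: "plane \<Rightarrow> plane \<Rightarrow> plane \<Rightarrow> plane \<Rightarrow> plane" where
  "complement_map A B C X = centroid A B C + (-1/2) *\<^sub>R (X - centroid A B C)"

definition T1 :: "plane \<Rightarrow> plane \<Rightarrow> plane \<Rightarrow> plane \<Rightarrow> plane" where
  "T1 A B C = triangle_map A B C
     (touch_point (incircle A B C) B C)
     (touch_point (incircle A B C) A C)
     (touch_point (incircle A B C) A B)"

definition T2 :: "plane \<Rightarrow> plane \<Rightarrow> plane \<Rightarrow> plane \<Rightarrow> plane" where
  "T2 A B C = triangle_map (excenter A B C) (excenter B A C) (excenter C A B) A B C"

definition Phi :: "plane \<Rightarrow> plane \<Rightarrow> plane \<Rightarrow> plane \<Rightarrow> plane" where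
  "Phi A B C = T1 A B C \<circ> inv (complement_map A B C) \<circ> T2 A B C \<circ> inv (complement_map A B C)"

definition equilateral :: "plane \<Rightarrow> plane \<Rightarrow> plane \<Rightarrow> bool" where
  "equilateral A B C \<longleftrightarrow> dist A B = dist B C \<and> dist B C = dist A C"

end

theory Submission
  imports Defs
begin

text \<open>Put \<open>k = 2r/R\<close> and let \<open>h\<close> be the homothety of ratio \<open>k\<close> sending the nine-point center \<open>N\<close> to
  the incenter \<open>I\<close>. The midpoint \<open>M\<close> of \<open>B'C'\<close> is the midpoint of the arc \<open>BAC\<close> of the circumcircle,
  so \<open>K M\<close> lies on the nine-point circle, the radius from \<open>N\<close> to \<open>K M\<close> is perpendicular to \<open>BC\<close>, and
  \<open>h (K M) = D\<close>. As \<open>M = T\<^sub>2\<^sup>-\<^sup>1 (K A)\<close>, the affine maps \<open>T\<^sub>1\<close> and \<open>h K T\<^sub>2\<^sup>-\<^sup>1 K\<close> agree on \<open>A\<close>, and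
  likewise on \<open>B\<close> and \<open>C\<close>; hence \<open>\<Phi> = h\<close>. Feuerbach's relation \<open>IN = \<bar>R/2 - r\<bar>\<close> says that the center
  of \<open>h\<close> is on the nine-point circle, and \<open>k = 1\<close> only for equilateral triangles.\<close>

section \<open>Affine maps, circles and tangency in the plane\<close>

lemma collinear_cross_iff:
  fixes A B C :: plane
  shows "collinear {A, B, C} \<longleftrightarrow>
    (B$1 - A$1) * (C$2 - A$2) = (B$2 - A$2) * (C$1 - A$1)"
proof (cases "A = B")
  case True
  then show ?thesis by simp
next
  case False
  have eq: "C \<in> affine hull {A, B} \<longleftrightarrow>
      (B$1 - A$1) * (C$2 - A$2) = (B$2 - A$2) * (C$1 - A$1)" (is "_ \<longleftrightarrow> ?r")
  proof
    assume "C \<in> affine hull {A, B}"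
    then obtain t where t: "C = A + t *\<^sub>R (B - A)"
      by (auto simp: affine_hull_2_alt)
    show ?r unfolding t by (simp add: algebra_simps)
  next
    assume r: ?r
    \<comment> \<open>The parameter of \<open>C\<close> on the line is read off in a coordinate in
      which \<open>A\<close> and \<open>B\<close> differ.\<close>
    have "B$1 - A$1 \<noteq> 0 \<or> B$2 - A$2 \<noteq> 0"
      using False by (auto simp: vec_eq_iff forall_2)
    then have "\<exists>t. C = A + t *\<^sub>R (B - A)"
    proof
      assume n: "B$1 - A$1 \<noteq> 0"
      have "C$2 - A$2 = (C$1 - A$1) / (B$1 - A$1) * (B$2 - A$2)"
        using r n by (simp only: times_divide_eq_left eq_divide_eq) (simp add: mult.commute)
      then have "C = A + ((C$1 - A$1) / (B$1 - A$1)) *\<^sub>R (B - A)"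
        using n by (simp add: vec_eq_iff forall_2)
      then show ?thesis ..
    next
      assume n: "B$2 - A$2 \<noteq> 0"
      have "C$1 - A$1 = (C$2 - A$2) / (B$2 - A$2) * (B$1 - A$1)"
        using r n by (simp only: times_divide_eq_left eq_divide_eq) (simp add: mult.commute)
      then have "C = A + ((C$2 - A$2) / (B$2 - A$2)) *\<^sub>R (B - A)"
        using n by (simp add: vec_eq_iff forall_2)
      then show ?thesis ..
    qed
    then show "C \<in> affine hull {A, B}" by (auto simp: affine_hull_2_alt)
  qed
  then show ?thesis using collinear_3_affine_hull[OF False, of C] by simp
qed

lemma inner_plane: "(u::plane) \<bullet> v = u$1 * v$1 + u$2 * v$2"
  by (simp add: inner_vec_def sum_2)

text \<open>By Cramer's rule the determinant \<open>d\<close> annihilates both coordinates of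
  \<open>w\<close>. Applied to a difference of two candidate points, this gives the uniqueness of
  centers and of the orthocenter.\<close>

lemma orthogonal_to_two_directions:
  fixes A B C w :: plane
  assumes "\<not> collinear {A, B, C}" "w \<bullet> (B - A) = 0" "w \<bullet> (C - A) = 0"
  shows "w = 0"
proof -
  define d where "d = (B$1 - A$1) * (C$2 - A$2) - (B$2 - A$2) * (C$1 - A$1)"
  have "d \<noteq> 0" using assms(1) by (simp add: collinear_cross_iff d_def)
  have e: "w$1 * (B$1 - A$1) + w$2 * (B$2 - A$2) = 0" "w$1 * (C$1 - A$1) + w$2 * (C$2 - A$2) = 0"
    using assms(2,3) by (simp_all add: inner_plane)
  have "w$1 * d = 0" "w$2 * d = 0" unfolding d_def using e by algebra+
  then show ?thesis using \<open>d \<noteq> 0\<close> by (simp add: vec_eq_iff forall_2)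
qed

lemma plane_affine_coordinates:
  fixes A B C X :: plane
  assumes "\<not> collinear {A, B, C}"
  obtains s t where "X = A + s *\<^sub>R (B - A) + t *\<^sub>R (C - A)"
proof -
  define d where "d = (B$1 - A$1) * (C$2 - A$2) - (B$2 - A$2) * (C$1 - A$1)"
  have d: "d \<noteq> 0" using assms(1) by (simp add: collinear_cross_iff d_def)
  \<comment> \<open>Cramer's quotients for the coordinates of \<open>X - A\<close> in the basis
    \<open>B - A\<close>, \<open>C - A\<close>.\<close>
  define s where "s = ((X$1 - A$1) * (C$2 - A$2) - (X$2 - A$2) * (C$1 - A$1)) / d"
  define t where "t = ((B$1 - A$1) * (X$2 - A$2) - (B$2 - A$2) * (X$1 - A$1)) / d"
  have sd: "s * d = (X$1 - A$1) * (C$2 - A$2) - (X$2 - A$2) * (C$1 - A$1)"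
    and td: "t * d = (B$1 - A$1) * (X$2 - A$2) - (B$2 - A$2) * (X$1 - A$1)"
    using d by (simp_all add: s_def t_def)
  have "d * (X$1 - A$1) = d * (s * (B$1 - A$1) + t * (C$1 - A$1))"
    "d * (X$2 - A$2) = d * (s * (B$2 - A$2) + t * (C$2 - A$2))"
    using sd td unfolding d_def by algebra+
  then have "X = A + s *\<^sub>R (B - A) + t *\<^sub>R (C - A)"
    using d by (simp add: vec_eq_iff forall_2)
  then show ?thesis by (rule that)
qed

section \<open>Affine maps and their values on a triangle\<close>

lemma affine_map_combination:
  assumes "affine_map f"
  shows "f (A + s *\<^sub>R (B - A) + t *\<^sub>R (C - A)) = f A + s *\<^sub>R (f B - f A) + t *\<^sub>R (f C - f A)"
proof -
  obtain M b where f: "f = (\<lambda>X. M *v X + b)" using assms unfolding affine_map_def by blast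
  show ?thesis unfolding f
    by (simp add: matrix_vector_right_distrib matrix_vector_mult_diff_distrib
        matrix_vector_mult_scaleR)
qed

lemma affine_map_unique:
  assumes "\<not> collinear {A, B, C}" "affine_map f" "affine_map g"
    "f A = g A" "f B = g B" "f C = g C"
  shows "f = g"
proof
  fix X
  obtain s t where "X = A + s *\<^sub>R (B - A) + t *\<^sub>R (C - A)"
    by (rule plane_affine_coordinates[OF assms(1)])
  then show "f X = g X" using assms by (simp add: affine_map_combination)
qed

text \<open>Evaluates the definite description: one affine map with the right vertex values is
  enough, because values on a nondegenerate triangle determine the map.\<close>

lemma triangle_map_eqI:
  assumes "\<not> collinear {X, Y, Z}" "affine_map f" "f X = U" "f Y = V" "f Z = W"
  shows "triangle_map X Y Z U V W = f"
  unfolding triangle_map_def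
proof (rule the_equality)
  show "affine_map f \<and> f X = U \<and> f Y = V \<and> f Z = W" using assms by blast
next
  fix g assume "affine_map g \<and> g X = U \<and> g Y = V \<and> g Z = W"
  with assms show "g = f" by (intro affine_map_unique[OF assms(1)]) auto
qed

text \<open>A matrix-free form, in which composition and inversion reduce to those of linear
  bijections.\<close>

lemma affine_map_iff_linear:
  "affine_map f \<longleftrightarrow> (\<exists>L b. linear L \<and> bij L \<and> f = (\<lambda>X. L X + b))"
proof
  assume "affine_map f"
  then obtain M b where "invertible M" "f = (\<lambda>X. M *v X + b)" unfolding affine_map_def by blast
  then show "\<exists>L b. linear L \<and> bij L \<and> f = (\<lambda>X. L X + b)"
    by (intro exI[of _ "(*v) M"] exI[of _ b]) (simp add: invertible_eq_bij)
next
  assume "\<exists>L b. linear L \<and> bij L \<and> f = (\<lambda>X. L X + b)"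
  then obtain L b where L: "linear L" "bij L" "f = (\<lambda>X. L X + b)" by blast
  have m: "(*v) (matrix L) = L" using L(1) by (auto intro: matrix_works)
  then show "affine_map f" unfolding affine_map_def
    using L by (intro exI[of _ "matrix L"] exI[of _ b]) (simp add: invertible_eq_bij)
qed

lemma affine_map_compose:
  assumes "affine_map f" "affine_map g"
  shows "affine_map (f \<circ> g)"
proof -
  obtain L b where f: "linear L" "bij L" "f = (\<lambda>X. L X + b)"
    using assms(1) unfolding affine_map_iff_linear by blast
  obtain L' b' where g: "linear L'" "bij L'" "g = (\<lambda>X. L' X + b')"
    using assms(2) unfolding affine_map_iff_linear by blast
  have "f \<circ> g = (\<lambda>X. (L \<circ> L') X + (L b' + b))"
    unfolding f(3) g(3) by (auto simp: linear_add[OF f(1)])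
  then show ?thesis unfolding affine_map_iff_linear
    using linear_compose[OF g(1) f(1)] bij_comp[OF g(2) f(2)] by blast
qed

lemma affine_map_bij:
  assumes "affine_map f"
  shows "bij f"
proof -
  obtain L b where f: "linear L" "bij L" "f = (\<lambda>X. L X + b)"
    using assms unfolding affine_map_iff_linear by blast
  have "f = (\<lambda>X. b + X) \<circ> L" unfolding f(3) by auto
  then show ?thesis using f(2) by (simp add: bij_comp)
qed

lemma affine_map_inv:
  assumes "affine_map f"
  shows "affine_map (inv f)"
proof -
  obtain L b where f: "linear L" "bij L" "f = (\<lambda>X. L X + b)"
    using assms unfolding affine_map_iff_linear by blast
  have li: "linear (inv L)"
    using f(1,2) by (simp add: bij_is_inj bij_is_surj linear_inj_imp_surj inj_linear_imp_inv_linear)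
  have "inv f = (\<lambda>X. inv L X + inv L (- b))"
  proof (rule inv_equality)
    fix X
    show "inv L (f X) + inv L (- b) = X"
      using f(2) unfolding f(3) by (simp flip: linear_add[OF li] add: bij_is_inj)
    show "f (inv L X + inv L (- b)) = X"
      using f(2) unfolding f(3) by (simp flip: linear_add[OF li] add: bij_is_surj surj_f_inv_f)
  qed
  then show ?thesis unfolding affine_map_iff_linear
    using li bij_imp_bij_inv[OF f(2)] by blast
qed

lemma affine_map_scale:
  assumes "k \<noteq> 0"
  shows "affine_map (\<lambda>X. P + k *\<^sub>R (X - Q))"
proof -
  have "bij (\<lambda>X::plane. k *\<^sub>R X)"
    using assms by (intro o_bij[where g = "\<lambda>X. (1/k) *\<^sub>R X"]) auto
  then show ?thesis unfolding affine_map_iff_linear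
    by (intro exI[of _ "\<lambda>X. k *\<^sub>R X"] exI[of _ "P - k *\<^sub>R Q"])
       (auto simp: algebra_simps)
qed

text \<open>The linear part sends the unit vectors to \<open>V - U\<close> and \<open>W - U\<close>.
  These span the plane, so it is surjective, hence injective by dimension.\<close>

lemma affine_map_exists_from_axes:
  assumes "\<not> collinear {U, V, W}"
  shows "\<exists>f. affine_map f \<and> f 0 = U \<and> f (axis 1 1) = V \<and> f (axis 2 1) = W"
proof -
  define L where "L = (\<lambda>X::plane. X$1 *\<^sub>R (V - U) + X$2 *\<^sub>R (W - U))"
  have lin: "linear L" unfolding L_def
    by (rule linearI) (auto simp: algebra_simps)
  have "surj L"
    unfolding surj_def
  proof
    fix Y
    obtain s t where "U + Y = U + s *\<^sub>R (V - U) + t *\<^sub>R (W - U)"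
      by (rule plane_affine_coordinates[OF assms])
    then have "L (s *\<^sub>R axis 1 1 + t *\<^sub>R axis 2 1) = Y"
      unfolding L_def by (simp add: axis_def)
    then show "\<exists>x. Y = L x" by metis
  qed
  then have "bij L" using lin by (simp add: bij_def linear_surjective_imp_injective)
  with lin have "affine_map (\<lambda>X. L X + U)" unfolding affine_map_iff_linear by blast
  then show ?thesis
    by (intro exI[of _ "\<lambda>X. L X + U"]) (simp add: L_def axis_def)
qed

text \<open>Both triangles are affine images of the reference triangle \<open>0\<close>,
  \<open>axis 1 1\<close>, \<open>axis 2 1\<close>: go back along one map and forward along the
  other.\<close>

lemma affine_map_exists:
  assumes "\<not> collinear {X, Y, Z}" "\<not> collinear {U, V, W}"
  obtains f where "affine_map f" "f X = U" "f Y = V" "f Z = W"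
proof -
  obtain g where g: "affine_map g" "g 0 = X" "g (axis 1 1) = Y" "g (axis 2 1) = Z"
    using affine_map_exists_from_axes[OF assms(1)] by blast
  obtain h where h: "affine_map h" "h 0 = U" "h (axis 1 1) = V" "h (axis 2 1) = W"
    using affine_map_exists_from_axes[OF assms(2)] by blast
  have "inv g X = 0" "inv g Y = axis 1 1" "inv g Z = axis 2 1"
    using affine_map_bij[OF g(1)] g by (auto intro: inv_f_eq bij_is_inj)
  then show ?thesis
    using h by (intro that[of "h \<circ> inv g"] affine_map_compose affine_map_inv g(1)) auto
qed

section \<open>Circles, tangent lines and tangent lengths\<close>

lemma sphere_determines_center:
  fixes Q Q' :: plane
  assumes "sphere Q r = sphere Q' r'" "r > 0"
  shows "Q = Q'" "r = r'"
proof -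
  show c: "Q = Q'"
  proof (rule ccontr)
    assume ne: "Q \<noteq> Q'"
    define w where "w = Q - Q'"
    \<comment> \<open>\<open>Q + u\<close> and \<open>Q - u\<close> end the diameter along the line
      of centers. Being equally far from \<open>Q'\<close>, they force \<open>w\<close> to be
      orthogonal to its own multiple \<open>u\<close>.\<close>
    define u where "u = (r / norm w) *\<^sub>R w"
    have w: "norm w > 0" using ne by (simp add: w_def)
    have "norm u = r" using w assms(2) by (simp add: u_def)
    then have "Q + u \<in> sphere Q r" "Q - u \<in> sphere Q r" by (simp_all add: dist_norm)
    then have "norm (w + u) = r'" "norm (w - u) = r'"
      unfolding assms(1) w_def by (simp_all add: dist_norm norm_minus_commute algebra_simps)
    then have "(w + u) \<bullet> (w + u) = (w - u) \<bullet> (w - u)" by (metis norm_eq)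
    then have "w \<bullet> u = 0" by (simp add: inner_commute algebra_simps)
    then show False using w assms(2) by (simp add: u_def)
  qed
  obtain u :: plane where "norm u = r" using assms(2) by (metis less_imp_le vector_choose_size)
  then have "Q + u \<in> sphere Q r" by (simp add: dist_norm)
  then have "Q + u \<in> sphere Q' r'" by (simp only: assms(1))
  then have "norm u = r'" by (simp add: c dist_norm)
  then show "r = r'" using \<open>norm u = r\<close> by (simp only:)
qed

text \<open>The direction \<open>e\<close> and the radius \<open>q\<close> are orthogonal and
  nonzero, hence a basis; the inner product with \<open>q\<close> isolates the
  \<open>q\<close>-coordinate of \<open>X - P\<close>, which vanishes exactly on the line.\<close>

lemma line_perpendicular:
  fixes B C P Q :: plane
  assumes "B \<noteq> C" "P \<in> affine hull {B, C}" "Q \<noteq> P" "(P - Q) \<bullet> (C - B) = 0"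
  shows "affine hull {B, C} = {X. (X - P) \<bullet> (P - Q) = 0}"
proof -
  obtain p where p: "P = B + p *\<^sub>R (C - B)" using assms(2) by (auto simp: affine_hull_2_alt)
  define q where "q = P - Q"
  define e where "e = C - B"
  have q: "q \<noteq> 0" "q \<bullet> e = 0" using assms by (auto simp: q_def e_def)
  have e: "e \<noteq> 0" using assms(1) by (simp add: e_def)
  have "X \<in> affine hull {B, C} \<longleftrightarrow> (X - P) \<bullet> q = 0" for X
  proof
    assume "X \<in> affine hull {B, C}"
    then obtain t where t: "X = B + t *\<^sub>R (C - B)" by (auto simp: affine_hull_2_alt)
    have "X - P = (t - p) *\<^sub>R e" unfolding t p e_def by (simp add: algebra_simps)
    then show "(X - P) \<bullet> q = 0" using q by (simp add: inner_commute)
  next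
    assume z: "(X - P) \<bullet> q = 0"
    have "\<not> collinear {0, e, q}"
    proof
      assume "collinear {0, e, q}"
      then obtain t where "q = t *\<^sub>R e" using e by (auto simp: collinear_lemma)
      then show False using q e by auto
    qed
    then obtain s t where st: "X - P = s *\<^sub>R e + t *\<^sub>R q"
      using plane_affine_coordinates[of 0 e q "X - P"] by auto
    have "t * (q \<bullet> q) = 0" using z q(2) unfolding st by (simp add: inner_add_left inner_commute[of e])
    then have "t = 0" using q by simp
    then have "X = B + (p + s) *\<^sub>R (C - B)" using st p unfolding e_def by (simp add: algebra_simps)
    then show "X \<in> affine hull {B, C}" by (auto simp: affine_hull_2_alt)
  qed
  then show ?thesis unfolding q_def by auto
qed

lemma tangent_at_sphere_iff:
  assumes "r > 0"
  shows "tangent_at (sphere Q r) l P \<longleftrightarrow> dist Q P = r \<and> l = {X. (X - P) \<bullet> (P - Q) = 0}"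
proof
  assume "tangent_at (sphere Q r) l P"
  then obtain Q' r' where h: "sphere Q r = sphere Q' r'" "P \<in> sphere Q r"
      "l = {X. (X - P) \<bullet> (P - Q') = 0}"
    unfolding tangent_at_def by metis
  have "Q = Q'" by (rule sphere_determines_center(1)[OF h(1) assms])
  then show "dist Q P = r \<and> l = {X. (X - P) \<bullet> (P - Q) = 0}" using h(2,3) by simp
next
  assume "dist Q P = r \<and> l = {X. (X - P) \<bullet> (P - Q) = 0}"
  then show "tangent_at (sphere Q r) l P" unfolding tangent_at_def
    using assms by (intro exI[of _ Q] exI[of _ r]) simp
qed

text \<open>Replaces an equality of lines by three conditions that can be computed from
  coordinates.\<close>

lemma tangent_at_line_iff:
  fixes B C P Q :: plane
  assumes "r > 0" "B \<noteq> C"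
  shows "tangent_at (sphere Q r) (affine hull {B, C}) P \<longleftrightarrow>
    dist Q P = r \<and> P \<in> affine hull {B, C} \<and> (P - Q) \<bullet> (C - B) = 0" (is "?l \<longleftrightarrow> ?r")
proof
  assume l: ?l
  then have h: "dist Q P = r" "affine hull {B, C} = {X. (X - P) \<bullet> (P - Q) = 0}"
    using tangent_at_sphere_iff[OF assms(1)] by auto
  moreover have "P \<in> affine hull {B, C}" unfolding h by simp
  moreover have "B \<in> affine hull {B, C}" "C \<in> affine hull {B, C}" by (simp_all add: hull_inc)
  then have "(B - P) \<bullet> (P - Q) = 0" "(C - P) \<bullet> (P - Q) = 0" unfolding h by simp_all
  then have "(P - Q) \<bullet> (C - B) = 0" by (simp add: algebra_simps inner_commute)
  ultimately show ?r by blast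
next
  assume r: ?r
  then have "Q \<noteq> P" using assms by auto
  then show ?l unfolding tangent_at_sphere_iff[OF assms(1)]
    using r line_perpendicular[OF assms(2)] by simp
qed

lemma tangent_at_unique:
  assumes "tangent_at S l P" "tangent_at S l P'"
  shows "P = P'"
proof -
  obtain Q r where Q: "r > 0" "S = sphere Q r" "l = {X. (X - P) \<bullet> (P - Q) = 0}"
    using assms(1) unfolding tangent_at_def by metis
  have l': "l = {X. (X - P') \<bullet> (P' - Q) = 0}"
    using assms(2) unfolding Q(2) tangent_at_sphere_iff[OF Q(1)] by (rule conjunct2)
  have "P' \<in> l" unfolding l' by simp
  moreover have "P \<in> l" unfolding Q(3) by simp
  ultimately have "(P' - P) \<bullet> (P - Q) = 0" "(P - P') \<bullet> (P' - Q) = 0"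
    by (simp add: Q(3), simp add: l')
  \<comment> \<open>Adding the two orthogonality relations eliminates \<open>Q\<close>.\<close>
  then have "(P - P') \<bullet> (P - P') = 0"
    by (simp add: algebra_simps inner_commute)
  then show ?thesis by simp
qed

lemma touch_point_eqI:
  assumes "tangent_at S (affine hull {X, Y}) P"
  shows "touch_point S X Y = P"
  unfolding touch_point_def by (rule the_equality, rule assms) (rule tangent_at_unique[OF _ assms])

text \<open>Pythagoras. The right-hand side involves only \<open>X\<close> and the circle, so all
  tangent segments from \<open>X\<close> have equal length.\<close>

lemma tangent_length:
  assumes "r > 0" "tangent_at (sphere Q r) l P" "X \<in> l"
  shows "dist X P = sqrt ((dist X Q)\<^sup>2 - r\<^sup>2)"
proof -
  have h: "dist Q P = r" "(X - P) \<bullet> (P - Q) = 0"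
    using assms(2,3) tangent_at_sphere_iff[OF assms(1)] by auto
  have "(dist X Q)\<^sup>2 = (dist X P)\<^sup>2 + (dist P Q)\<^sup>2"
    using h(2) unfolding dist_norm power2_norm_eq_inner by (simp add: algebra_simps inner_commute)
  then show ?thesis using h(1) by (simp add: dist_commute)
qed

lemma on_segment_dist:
  fixes B C P :: plane
  assumes "P \<in> closed_segment B C"
  shows "dist B P + dist P C = dist B C"
  using assms by (metis between between_mem_segment)

text \<open>The alternatives are a point beyond \<open>B\<close> and a point beyond
  \<open>A\<close>. They are expressed through distances so that tangent lengths can decide between
  them.\<close>

lemma on_line_beyond:
  fixes A B P :: plane
  assumes "P \<in> affine hull {A, B} - closed_segment A B"
  shows "dist A P = dist A B + dist B P \<and> P = A + (dist A P / dist A B) *\<^sub>R (B - A)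
    \<or> dist B P = dist A B + dist A P"
proof -
  obtain t where t: "P = A + t *\<^sub>R (B - A)"
    using assms by (auto simp: affine_hull_2_alt)
  have n: "t < 0 \<or> t > 1"
  proof (rule ccontr)
    assume "\<not> (t < 0 \<or> t > 1)"
    then have "P \<in> closed_segment A B" unfolding in_segment t
      by (intro exI[of _ t]) (auto simp: algebra_simps)
    then show False using assms by blast
  qed
  have "B \<noteq> A" using assms by auto
  have d1: "dist A P = \<bar>t\<bar> * dist A B" unfolding t dist_norm by (simp add: norm_minus_commute)
  have "B - P = (1 - t) *\<^sub>R (B - A)" unfolding t by (simp add: algebra_simps)
  then have d2: "dist B P = \<bar>1 - t\<bar> * dist A B" unfolding dist_norm by (simp add: norm_minus_commute)
  from n show ?thesis
  proof
    assume "t < 0"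
    then show ?thesis unfolding d1 d2 by (simp add: algebra_simps)
  next
    assume "t > 1"
    moreover from this have "t = dist A P / dist A B" using d1 \<open>B \<noteq> A\<close> by simp
    ultimately show ?thesis using t unfolding d1 d2 by (simp add: algebra_simps)
  qed
qed

lemma on_segment_eq:
  fixes B C P :: plane
  assumes "P \<in> closed_segment B C" "B \<noteq> C"
  shows "P = B + (dist B P / dist B C) *\<^sub>R (C - B)"
proof -
  obtain t where t: "P = B + t *\<^sub>R (C - B)" "0 \<le> t"
    using assms(1) by (auto simp: in_segment algebra_simps)
  have "dist B P = t * dist B C" using t(2) unfolding t(1) dist_norm by (simp add: norm_minus_commute)
  then show ?thesis using t(1) assms(2) by simp
qed

text \<open>Equality would put \<open>A\<close> on the segment \<open>BC\<close>. Strictness is what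
  makes the Ravi coordinates positive.\<close>

lemma strict_triangle_inequality:
  fixes A B C :: plane
  assumes "\<not> collinear {A, B, C}"
  shows "dist B C < dist A B + dist A C"
proof -
  have "\<not> between (B, C) A"
    using assms between_imp_collinear by (metis insert_commute)
  then show ?thesis
    using dist_triangle[of B C A] by (simp add: between dist_commute)
qed

section \<open>The incircle and the excircles\<close>

definition bary :: "plane \<Rightarrow> plane \<Rightarrow> plane \<Rightarrow> real \<Rightarrow> real \<Rightarrow> real \<Rightarrow> plane" where
  "bary A B C p q r = p *\<^sub>R A + q *\<^sub>R B + r *\<^sub>R C"

lemma bary_diff: "bary A B C p q r - bary A B C p' q' r' = bary A B C (p - p') (q - q') (r - r')"
  by (simp add: bary_def algebra_simps)

lemma bary_add: "bary A B C p q r + bary A B C p' q' r' = bary A B C (p + p') (q + q') (r + r')"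
  by (simp add: bary_def algebra_simps)

lemma bary_scale: "k *\<^sub>R bary A B C p q r = bary A B C (k * p) (k * q) (k * r)"
  by (simp add: bary_def algebra_simps)

lemma bary_vertices:
  "bary A B C 1 0 0 = A" "bary A B C 0 1 0 = B" "bary A B C 0 0 1 = C"
  by (simp_all add: bary_def)

text \<open>With weight sum 0 both vectors are combinations of \<open>u\<close> and
  \<open>v\<close>, whose inner products follow from the side lengths by polarization. Metric claims
  thereby become rational identities in the side lengths.\<close>

lemma inner_bary:
  assumes "p + q + r = 0" "p' + q' + r' = 0"
  shows "bary A B C p q r \<bullet> bary A B C p' q' r' =
    - ((dist B C)\<^sup>2 * (q * r' + r * q') + (dist C A)\<^sup>2 * (r * p' + p * r')
      + (dist A B)\<^sup>2 * (p * q' + q * p')) / 2"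
proof -
  define u where "u = B - A"
  define v where "v = C - A"
  have p: "p = - q - r" "p' = - q' - r'" using assms by simp_all
  have b: "bary A B C p q r = q *\<^sub>R u + r *\<^sub>R v" "bary A B C p' q' r' = q' *\<^sub>R u + r' *\<^sub>R v"
    unfolding p bary_def u_def v_def by (simp_all add: algebra_simps)
  have "B - C = u - v" by (simp add: u_def v_def)
  then have d: "(dist B C)\<^sup>2 = (u - v) \<bullet> (u - v)" "(dist C A)\<^sup>2 = v \<bullet> v" "(dist A B)\<^sup>2 = u \<bullet> u"
    unfolding dist_norm power2_norm_eq_inner by (simp_all add: u_def v_def algebra_simps inner_commute)
  show ?thesis unfolding b d unfolding p
    by (simp add: inner_diff_left inner_diff_right inner_add_left inner_add_right
        inner_commute[of v u] field_simps)
qed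

text \<open>Ravi coordinates: \<open>x\<close>, \<open>y\<close>, \<open>z\<close> are the tangent lengths from the vertices to the incircle, so
  that \<open>a = y + z\<close>, \<open>b + c - a = 2 x\<close>, and \<open>x + y + z\<close> is the semiperimeter.\<close>

definition incenter_pt :: "plane \<Rightarrow> plane \<Rightarrow> plane \<Rightarrow> real \<Rightarrow> real \<Rightarrow> real \<Rightarrow> plane" where
  "incenter_pt A B C x y z = bary A B C ((y + z) / (2 * (x + y + z)))
     ((z + x) / (2 * (x + y + z))) ((x + y) / (2 * (x + y + z)))"

text \<open>Area over semiperimeter, with Heron's area
  \<open>sqrt (x * y * z * (x + y + z))\<close>.\<close>

definition inradius :: "real \<Rightarrow> real \<Rightarrow> real \<Rightarrow> real" where
  "inradius x y z = sqrt (x * y * z / (x + y + z))"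

text \<open>On a side of length \<open>y + z\<close> this is the point at distance \<open>y\<close>
  from \<open>B\<close> and \<open>z\<close> from \<open>C\<close>. Exchanging the two lengths gives
  the contact point of the excircle.\<close>

definition contact_pt :: "plane \<Rightarrow> plane \<Rightarrow> real \<Rightarrow> real \<Rightarrow> plane" where
  "contact_pt B C y z = (z / (y + z)) *\<^sub>R B + (y / (y + z)) *\<^sub>R C"

text \<open>The weights \<open>-a : b : c\<close>, normalized by
  \<open>b + c - a = 2 * x\<close>.\<close>

definition excenter_pt :: "plane \<Rightarrow> plane \<Rightarrow> plane \<Rightarrow> real \<Rightarrow> real \<Rightarrow> real \<Rightarrow> plane" where
  "excenter_pt A B C x y z =
     bary A B C (- (y + z) / (2 * x)) ((z + x) / (2 * x)) ((x + y) / (2 * x))"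

text \<open>Heron's area divided by \<open>x\<close>, the semiperimeter minus the side
  \<open>a\<close>.\<close>

definition exradius :: "real \<Rightarrow> real \<Rightarrow> real \<Rightarrow> real" where
  "exradius x y z = sqrt (y * z * (x + y + z) / x)"

lemma contact_pt_open_segment:
  assumes "B \<noteq> C" "y > 0" "z > 0"
  shows "contact_pt B C y z \<in> open_segment B C"
proof -
  have "1 - y / (y + z) = z / (y + z)" using assms by (simp add: field_simps)
  then show ?thesis unfolding in_segment contact_pt_def using assms
    by (intro conjI exI[of _ "y / (y + z)"]) simp_all
qed

lemma incenter_pt_perm:
  "incenter_pt C A B z x y = incenter_pt A B C x y z"
  "incenter_pt B A C y x z = incenter_pt A B C x y z"
  by (simp_all add: incenter_pt_def bary_def ac_simps)

lemma inradius_perm: "inradius z x y = inradius x y z" "inradius y x z = inradius x y z"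
  by (simp_all add: inradius_def ac_simps)

lemma excenter_pt_perm: "excenter_pt A C B x z y = excenter_pt A B C x y z"
  by (simp_all add: excenter_pt_def bary_def ac_simps)

text \<open>The lengths are parameters, so that relabelling the vertices permutes \<open>x\<close>,
  \<open>y\<close>, \<open>z\<close> and a fact about one vertex or side can be instantiated for the
  others.\<close>

locale ravi_triangle =
  fixes A B C :: plane and x y z :: real
  assumes noncollinear: "\<not> collinear {A, B, C}"
    and pos: "x > 0" "y > 0" "z > 0"
    and sides: "dist B C = y + z" "dist C A = z + x" "dist A B = x + y"
begin

lemma rotate: "ravi_triangle B C A y z x"
  using noncollinear pos sides
  by unfold_locales (simp_all add: insert_commute)

lemma swap: "ravi_triangle A C B x z y"
  using noncollinear pos sides
  by unfold_locales (simp_all add: insert_commute dist_commute add.commute)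

text \<open>The relabellings that bring \<open>C\<close> and \<open>B\<close> into the first
  place.\<close>

lemma permuted: "ravi_triangle C A B z x y" "ravi_triangle B A C y x z"
  using ravi_triangle.rotate[OF rotate] ravi_triangle.rotate[OF ravi_triangle.rotate[OF swap]] .

lemma nonzero: "x \<noteq> 0" "y \<noteq> 0" "z \<noteq> 0" "x + y + z \<noteq> 0" "y + z \<noteq> 0" "z + x \<noteq> 0" "x + y \<noteq> 0"
  using pos by auto

lemma distinct: "A \<noteq> B" "B \<noteq> C" "A \<noteq> C"
  using noncollinear by (auto simp: insert_commute)

lemma norm_bary:
  assumes "p + q + r = 0"
  shows "(norm (bary A B C p q r))\<^sup>2 =
    - ((y + z)\<^sup>2 * (q * r) + (z + x)\<^sup>2 * (r * p) + (x + y)\<^sup>2 * (p * q))"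
  unfolding power2_norm_eq_inner inner_bary[OF assms assms] sides by (simp add: field_simps)

lemma inradius_pos: "inradius x y z > 0"
  using pos by (simp add: inradius_def)

lemma inradius_sq: "(inradius x y z)\<^sup>2 = x * y * z / (x + y + z)"
  using pos by (simp add: inradius_def)

lemma exradius_pos: "exradius x y z > 0"
  using pos by (simp add: exradius_def)

lemma contact_pt_bary: "contact_pt B C y z = bary A B C 0 (z / (y + z)) (y / (y + z))"
  by (simp add: contact_pt_def bary_def)

lemma contact_pt_line: "contact_pt B C y z = B + (y / (y + z)) *\<^sub>R (C - B)"
proof -
  have "z / (y + z) = 1 - y / (y + z)" using nonzero by (simp add: field_simps)
  then show ?thesis by (simp only: contact_pt_def) (simp add: algebra_simps)
qed

text \<open>The vector from the contact point to the incenter has weight sum 0, so its length and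
  its inner product with \<open>C - B\<close> are rational functions of \<open>x\<close>,
  \<open>y\<close>, \<open>z\<close>; clearing denominators leaves polynomial identities.\<close>

lemma incircle_tangent:
  "tangent_at (sphere (incenter_pt A B C x y z) (inradius x y z)) (affine hull {B, C}) (contact_pt B C y z)"
proof -
  let ?p = "(y + z) / (2 * (x + y + z))"
  let ?q = "(z + x) / (2 * (x + y + z)) - z / (y + z)"
  let ?r = "(x + y) / (2 * (x + y + z)) - y / (y + z)"
  have d: "incenter_pt A B C x y z - contact_pt B C y z = bary A B C ?p ?q ?r"
    unfolding incenter_pt_def contact_pt_bary bary_diff by simp
  have s: "?p + ?q + ?r = 0" using nonzero by (simp add: divide_simps) algebra
  have "(norm (bary A B C ?p ?q ?r))\<^sup>2 = x * y * z / (x + y + z)"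
    unfolding norm_bary[OF s] using nonzero by (simp add: divide_simps) algebra
  then have n: "dist (incenter_pt A B C x y z) (contact_pt B C y z) = inradius x y z"
    unfolding dist_norm d by (simp add: inradius_def real_sqrt_unique[symmetric])
  have e: "0 + (- 1) + 1 = (0::real)" by simp
  have cb: "C - B = bary A B C 0 (- 1) 1" by (simp add: bary_def)
  have "(bary A B C ?p ?q ?r) \<bullet> (C - B) = 0"
    unfolding cb inner_bary[OF s e] sides
    using nonzero by (simp add: divide_simps) algebra
  then have "(contact_pt B C y z - incenter_pt A B C x y z) \<bullet> (C - B) = 0"
    unfolding d[symmetric] by (simp add: inner_diff_left)
  then show ?thesis
    unfolding tangent_at_line_iff[OF inradius_pos distinct(2)]
    using n contact_pt_line by (auto simp: affine_hull_2_alt)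
qed

lemma excircle_tangent_side:
  "tangent_at (sphere (excenter_pt A B C x y z) (exradius x y z)) (affine hull {B, C}) (contact_pt B C z y)"
proof -
  let ?p = "- (y + z) / (2 * x)"
  let ?q = "(z + x) / (2 * x) - y / (y + z)"
  let ?r = "(x + y) / (2 * x) - z / (y + z)"
  have d: "excenter_pt A B C x y z - contact_pt B C z y = bary A B C ?p ?q ?r"
    unfolding excenter_pt_def contact_pt_def by (simp add: bary_def algebra_simps)
  have s: "?p + ?q + ?r = 0" using nonzero by (simp add: divide_simps) algebra
  have "(norm (bary A B C ?p ?q ?r))\<^sup>2 = y * z * (x + y + z) / x"
    unfolding norm_bary[OF s] using nonzero by (simp add: divide_simps) algebra
  then have n: "dist (excenter_pt A B C x y z) (contact_pt B C z y) = exradius x y z"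
    unfolding dist_norm d by (simp add: exradius_def real_sqrt_unique[symmetric])
  have e: "0 + (- 1) + 1 = (0::real)" by simp
  have cb: "C - B = bary A B C 0 (- 1) 1" by (simp add: bary_def)
  have "(bary A B C ?p ?q ?r) \<bullet> (C - B) = 0"
    unfolding cb inner_bary[OF s e] sides
    using nonzero by (simp add: divide_simps) algebra
  then have "(contact_pt B C z y - excenter_pt A B C x y z) \<bullet> (C - B) = 0"
    unfolding d[symmetric] by (simp add: inner_diff_left)
  moreover have "contact_pt B C z y \<in> affine hull {B, C}"
    using contact_pt_open_segment[OF distinct(2) pos(3,2)]
    by (auto simp: open_segment_def segment_convex_hull dest: subsetD[OF convex_hull_subset_affine_hull])
  ultimately show ?thesis
    unfolding tangent_at_line_iff[OF exradius_pos distinct(2)] using n by blast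
qed

text \<open>The point of contact lies at distance \<open>x + y + z\<close>, the semiperimeter, from
  \<open>A\<close>. The verification is the same barycentric computation.\<close>

lemma excircle_tangent_extension:
  "tangent_at (sphere (excenter_pt A B C x y z) (exradius x y z)) (affine hull {A, B})
     (A + ((x + y + z) / (x + y)) *\<^sub>R (B - A))" (is "tangent_at _ _ ?P")
proof -
  let ?p = "- (y + z) / (2 * x) - (1 - (x + y + z) / (x + y))"
  let ?q = "(z + x) / (2 * x) - (x + y + z) / (x + y)"
  let ?r = "(x + y) / (2 * x)"
  have d: "excenter_pt A B C x y z - ?P = bary A B C ?p ?q ?r"
    unfolding excenter_pt_def by (simp add: bary_def algebra_simps)
  have s: "?p + ?q + ?r = 0" using nonzero by (simp add: divide_simps) algebra
  have "(norm (bary A B C ?p ?q ?r))\<^sup>2 = y * z * (x + y + z) / x"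
    unfolding norm_bary[OF s] using nonzero by (simp add: divide_simps) algebra
  then have n: "dist (excenter_pt A B C x y z) ?P = exradius x y z"
    unfolding dist_norm d by (simp add: exradius_def real_sqrt_unique[symmetric])
  have e: "(- 1) + 1 + 0 = (0::real)" by simp
  have ba: "B - A = bary A B C (- 1) 1 0" by (simp add: bary_def)
  have "(bary A B C ?p ?q ?r) \<bullet> (B - A) = 0"
    unfolding ba inner_bary[OF s e] sides
    using nonzero by (simp add: divide_simps) algebra
  then have "(?P - excenter_pt A B C x y z) \<bullet> (B - A) = 0"
    unfolding d[symmetric] by (simp add: inner_diff_left)
  then show ?thesis
    unfolding tangent_at_line_iff[OF exradius_pos distinct(1)]
    using n by (auto simp: affine_hull_2_alt)
qed

lemma incircle_touches_side:
  "touches_side (sphere (incenter_pt A B C x y z) (inradius x y z)) B C"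
  unfolding touches_side_def using incircle_tangent contact_pt_open_segment[OF distinct(2) pos(2,3)] by blast

lemma excircle_touches_side:
  "touches_side (sphere (excenter_pt A B C x y z) (exradius x y z)) B C"
  unfolding touches_side_def
  using excircle_tangent_side contact_pt_open_segment[OF distinct(2) pos(3,2)] by blast

lemma excircle_touches_extension:
  "touches_extension (sphere (excenter_pt A B C x y z) (exradius x y z)) A B"
proof -
  let ?t = "(x + y + z) / (x + y)"
  let ?P = "A + ?t *\<^sub>R (B - A)"
  \<comment> \<open>A parameter above 1 places the contact point beyond \<open>B\<close>.\<close>
  have "?t > 1" using pos by simp
  have "?P \<notin> closed_segment A B"
  proof
    assume "?P \<in> closed_segment A B"
    then obtain u where u: "u \<le> 1" "?P = (1 - u) *\<^sub>R A + u *\<^sub>R B" unfolding in_segment by blast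
    then have "(?t - u) *\<^sub>R (B - A) = 0" by (simp add: algebra_simps)
    then show False using \<open>?t > 1\<close> u(1) distinct by simp
  qed
  then show ?thesis unfolding touches_extension_def
    using excircle_tangent_extension by (intro bexI[of _ ?P]) (auto simp: affine_hull_2_alt)
qed

lemma inner_sides_eqI:
  assumes "(P - Q) \<bullet> (B - A) = 0" "(P - Q) \<bullet> (C - A) = 0"
  shows "P = Q"
  using orthogonal_to_two_directions[OF noncollinear assms] by simp

text \<open>The two tangent segments from each vertex have equal length; this determines the points of
  contact, and they determine the center.\<close>

lemma incircle_unique:
  assumes "is_circle S" "touches_side S B C" "touches_side S A C" "touches_side S A B"
  shows "S = sphere (incenter_pt A B C x y z) (inradius x y z)"
proof -
  interpret q: ravi_triangle C A B z x y by (rule permuted(1))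
  define I where "I = incenter_pt A B C x y z"
  obtain Q r where r: "r > 0" "S = sphere Q r" using assms(1) unfolding is_circle_def by blast
  obtain P1 where P1: "P1 \<in> open_segment B C" "tangent_at (sphere Q r) (affine hull {B, C}) P1"
    using assms(2) r(2) unfolding touches_side_def by blast
  obtain P2 where P2: "P2 \<in> open_segment A C" "tangent_at (sphere Q r) (affine hull {A, C}) P2"
    using assms(3) r(2) unfolding touches_side_def by blast
  obtain P3 where P3: "P3 \<in> open_segment A B" "tangent_at (sphere Q r) (affine hull {A, B}) P3"
    using assms(4) r(2) unfolding touches_side_def by blast
  define l where "l X = sqrt ((dist X Q)\<^sup>2 - r\<^sup>2)" for X
  have tl: "dist X P = l X" if "tangent_at (sphere Q r) L P" "X \<in> L" for X L P
    unfolding l_def by (rule tangent_length[OF r(1) that])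
  have seg: "P1 \<in> closed_segment B C" "P2 \<in> closed_segment A C" "P3 \<in> closed_segment A B"
    using P1(1) P2(1) P3(1) open_closed_segment by blast+
  have d: "dist B P1 = l B" "dist C P1 = l C" "dist A P2 = l A" "dist C P2 = l C"
    "dist A P3 = l A" "dist B P3 = l B"
    by (rule tl[OF P1(2)] tl[OF P2(2)] tl[OF P3(2)], simp add: hull_inc)+
  have "l B + l C = y + z" "l A + l C = z + x" "l A + l B = x + y"
    using on_segment_dist[OF seg(1)] on_segment_dist[OF seg(2)] on_segment_dist[OF seg(3)] d sides
    by (simp_all add: dist_commute)
  \<comment> \<open>The three pairwise sums of the tangent lengths are the side lengths, a linear
    system solved by the Ravi coordinates.\<close>
  then have l: "l A = x" "l B = y" by linarith+
  have e1: "P1 = contact_pt B C y z"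
    using on_segment_eq[OF seg(1) distinct(2)] unfolding d l sides contact_pt_line .
  have e3: "P3 = contact_pt A B x y"
    using on_segment_eq[OF seg(3) distinct(1)] unfolding d l sides q.contact_pt_line .
  have t1: "(P1 - Q) \<bullet> (C - B) = 0" "(P1 - I) \<bullet> (C - B) = 0" "dist Q P1 = r"
    "dist I P1 = inradius x y z"
    using P1(2) incircle_tangent unfolding tangent_at_line_iff[OF r(1) distinct(2)]
      tangent_at_line_iff[OF inradius_pos distinct(2)] I_def e1 by blast+
  have t3: "(P3 - Q) \<bullet> (B - A) = 0" "(P3 - I) \<bullet> (B - A) = 0"
    using P3(2) q.incircle_tangent
    unfolding tangent_at_line_iff[OF r(1) distinct(1)] tangent_at_line_iff[OF q.inradius_pos distinct(1)]
      I_def e3 incenter_pt_perm(1)[of C A B z x y]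
    by blast+
  \<comment> \<open>\<open>Q\<close> and \<open>I\<close> lie on the same perpendiculars to
    \<open>AB\<close> at \<open>P3\<close> and to \<open>BC\<close> at \<open>P1\<close>.\<close>
  have 1: "(Q - I) \<bullet> (B - A) = 0" "(Q - I) \<bullet> (C - B) = 0"
    using t1(1,2) t3 by (simp_all add: inner_diff_left)
  moreover have "C - A = (C - B) + (B - A)" by simp
  ultimately have "(Q - I) \<bullet> (C - A) = 0" by (simp only: inner_add_right)
  then have "Q = I" using 1(1) inner_sides_eqI by blast
  then show ?thesis using r(2) t1(3,4) I_def by simp
qed

lemma incircle_eq: "incircle A B C = sphere (incenter_pt A B C x y z) (inradius x y z)"
  unfolding incircle_def
proof (rule the_equality)
  interpret s: ravi_triangle B A C y x z by (rule permuted(2))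
  interpret q: ravi_triangle C A B z x y by (rule permuted(1))
  show "is_circle (sphere (incenter_pt A B C x y z) (inradius x y z)) \<and>
    touches_side (sphere (incenter_pt A B C x y z) (inradius x y z)) B C \<and>
    touches_side (sphere (incenter_pt A B C x y z) (inradius x y z)) A C \<and>
    touches_side (sphere (incenter_pt A B C x y z) (inradius x y z)) A B"
    using incircle_touches_side inradius_pos
      s.incircle_touches_side[unfolded incenter_pt_perm(2)[of B A C y x z] inradius_perm(2)[of y x z]]
      q.incircle_touches_side[unfolded incenter_pt_perm(1)[of C A B z x y] inradius_perm(1)[of z x y]]
    unfolding is_circle_def by blast
qed (use incircle_unique in blast)

text \<open>The tangent lengths force the contact points on the extended sides to lie beyond
  \<open>B\<close> and \<open>C\<close>, at distance \<open>x + y + z\<close> from \<open>A\<close>.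
  The perpendiculars at these points meet only in the excenter.\<close>

lemma excenter_unique:
  assumes r: "r > 0" and t: "touches_side (sphere Q r) B C"
    "touches_extension (sphere Q r) A B" "touches_extension (sphere Q r) A C"
  shows "Q = excenter_pt A B C x y z"
proof -
  interpret s: ravi_triangle A C B x z y by (rule swap)
  define J where "J = excenter_pt A B C x y z"
  obtain P1 where P1: "P1 \<in> open_segment B C" "tangent_at (sphere Q r) (affine hull {B, C}) P1"
    using t(1) unfolding touches_side_def by blast
  obtain P2 where P2: "P2 \<in> affine hull {A, C} - closed_segment A C"
      "tangent_at (sphere Q r) (affine hull {A, C}) P2"
    using t(3) unfolding touches_extension_def by blast
  obtain P3 where P3: "P3 \<in> affine hull {A, B} - closed_segment A B"
      "tangent_at (sphere Q r) (affine hull {A, B}) P3"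
    using t(2) unfolding touches_extension_def by blast
  define l where "l X = sqrt ((dist X Q)\<^sup>2 - r\<^sup>2)" for X
  have tl: "dist X P = l X" if "tangent_at (sphere Q r) L P" "X \<in> L" for X L P
    unfolding l_def by (rule tangent_length[OF r that])
  have seg: "P1 \<in> closed_segment B C" using P1(1) open_closed_segment by blast
  have d: "dist B P1 = l B" "dist C P1 = l C" "dist A P2 = l A" "dist C P2 = l C"
    "dist A P3 = l A" "dist B P3 = l B"
    by (rule tl[OF P1(2)] tl[OF P2(2)] tl[OF P3(2)], simp add: hull_inc)+
  have nn: "l A \<ge> 0" "l B \<ge> 0" "l C \<ge> 0" using d zero_le_dist by metis+
  have lBC: "l B + l C = y + z"
    using on_segment_dist[OF seg] d sides by (simp add: dist_commute)
  have o3: "l A = x + y + l B \<and> P3 = A + (l A / (x + y)) *\<^sub>R (B - A) \<or> l B = x + y + l A"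
    using on_line_beyond[OF P3(1)] unfolding d sides .
  have o2: "l A = x + z + l C \<and> P2 = A + (l A / (x + z)) *\<^sub>R (C - A) \<or> l C = x + z + l A"
    using on_line_beyond[OF P2(1)] unfolding d s.sides .
  \<comment> \<open>Were either contact point beyond \<open>A\<close>, \<open>l B + l C\<close>
    would exceed \<open>y + z\<close>. In the remaining case, adding the two equations for
    \<open>l A\<close> gives its value.\<close>
  have "l A = x + y + z" "P3 = A + (l A / (x + y)) *\<^sub>R (B - A)" "P2 = A + (l A / (x + z)) *\<^sub>R (C - A)"
    using o3 o2 lBC nn pos by auto
  then have e: "P3 = A + ((x + y + z) / (x + y)) *\<^sub>R (B - A)" "P2 = A + ((x + z + y) / (x + z)) *\<^sub>R (C - A)"
    by (simp_all add: ac_simps)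
  have t3: "(P3 - Q) \<bullet> (B - A) = 0" "(P3 - J) \<bullet> (B - A) = 0"
    using P3(2) excircle_tangent_extension
    unfolding tangent_at_line_iff[OF r distinct(1)] tangent_at_line_iff[OF exradius_pos distinct(1)]
      J_def e by blast+
  have t2: "(P2 - Q) \<bullet> (C - A) = 0" "(P2 - J) \<bullet> (C - A) = 0"
    using P2(2) s.excircle_tangent_extension
    unfolding tangent_at_line_iff[OF r distinct(3)] tangent_at_line_iff[OF s.exradius_pos distinct(3)]
      J_def e excenter_pt_perm[of A C B x z y] by blast+
  have "(Q - J) \<bullet> (B - A) = 0" "(Q - J) \<bullet> (C - A) = 0"
    using t3 t2 by (simp_all add: inner_diff_left)
  then show ?thesis unfolding J_def by (rule inner_sides_eqI)
qed

lemma excenter_eq: "excenter A B C = excenter_pt A B C x y z"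
  unfolding excenter_def
proof (rule the_equality)
  interpret s: ravi_triangle A C B x z y by (rule swap)
  have "exradius x z y = exradius x y z" by (simp add: exradius_def ac_simps)
  then show "\<exists>r>0. touches_side (sphere (excenter_pt A B C x y z) r) B C \<and>
     touches_extension (sphere (excenter_pt A B C x y z) r) A B \<and>
     touches_extension (sphere (excenter_pt A B C x y z) r) A C"
    using exradius_pos excircle_touches_side excircle_touches_extension
      s.excircle_touches_extension[unfolded excenter_pt_perm[of A C B x z y]]
    by (intro exI[of _ "exradius x y z"]) simp
qed (use excenter_unique in blast)

end

section \<open>The nine-point circle\<close>

text \<open>With \<open>O'\<close> the circumcenter, the vector from \<open>A\<close> to this point
  is \<open>B + C - 2 *\<^sub>R O'\<close>. Its inner product with \<open>C - B\<close> is the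
  difference of the squared distances of \<open>C\<close> and \<open>B\<close> from
  \<open>O'\<close>, which is zero.\<close>

lemma orthocenter_eq:
  fixes A B C O' :: plane
  assumes "\<not> collinear {A, B, C}" "dist O' A = R" "dist O' B = R" "dist O' C = R"
  shows "orthocenter A B C = A + B + C - 2 *\<^sub>R O'"
  unfolding orthocenter_def
proof (rule the_equality)
  have e: "(B + C - 2 *\<^sub>R O') \<bullet> (C - B) = 0"
    if "dist O' B = R" "dist O' C = R" for B C
  proof -
    have "norm (C - O') = norm (B - O')" using that by (simp add: dist_norm norm_minus_commute)
    then have "(C - O') \<bullet> (C - O') = (B - O') \<bullet> (B - O')" by (simp only: norm_eq)
    then show ?thesis by (simp add: algebra_simps inner_commute)
  qed
  show "(A + B + C - 2 *\<^sub>R O' - A) \<bullet> (C - B) = 0 \<and>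
    (A + B + C - 2 *\<^sub>R O' - B) \<bullet> (A - C) = 0 \<and> (A + B + C - 2 *\<^sub>R O' - C) \<bullet> (B - A) = 0"
    using e[of B C] e[of C A] e[of A B] assms by (simp add: algebra_simps)
  then have z: "(A + B + C - 2 *\<^sub>R O' - A) \<bullet> (C - B) = 0" "(A + B + C - 2 *\<^sub>R O' - B) \<bullet> (A - C) = 0"
    by blast+
  fix H
  assume "(H - A) \<bullet> (C - B) = 0 \<and> (H - B) \<bullet> (A - C) = 0 \<and> (H - C) \<bullet> (B - A) = 0"
  then have "(H - (A + B + C - 2 *\<^sub>R O')) \<bullet> (B - C) = 0" "(H - (A + B + C - 2 *\<^sub>R O')) \<bullet> (A - C) = 0"
    using z by (simp_all add: inner_diff_left inner_diff_right inner_add_left)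
  moreover have "\<not> collinear {C, B, A}" using assms(1) by (simp add: insert_commute)
  ultimately have "H - (A + B + C - 2 *\<^sub>R O') = 0" by (intro orthogonal_to_two_directions)
  then show "H = A + B + C - 2 *\<^sub>R O'" by simp
qed

text \<open>On the line \<open>BC\<close> the orthogonality condition is linear in the parameter
  with nonzero leading coefficient, so the projection \<open>?t\<close> is its only solution and the
  description is well defined.\<close>

lemma altitude_foot:
  assumes "B \<noteq> C"
  shows "altitude_foot A B C \<in> affine hull {B, C}" "(altitude_foot A B C - A) \<bullet> (C - B) = 0"
proof -
  let ?Q = "\<lambda>P. P \<in> affine hull {B, C} \<and> (P - A) \<bullet> (C - B) = 0"
  let ?t = "((A - B) \<bullet> (C - B)) / ((C - B) \<bullet> (C - B))"
  have n: "(C - B) \<bullet> (C - B) \<noteq> 0" using assms by simp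
  have q: "(B + t *\<^sub>R (C - B) - A) \<bullet> (C - B) = t * ((C - B) \<bullet> (C - B)) - (A - B) \<bullet> (C - B)" for t
    by (simp add: inner_diff_left inner_add_left)
  have "?Q (B + ?t *\<^sub>R (C - B))" using n unfolding q by (simp add: affine_hull_2_alt)
  moreover have "P = B + ?t *\<^sub>R (C - B)" if Q: "?Q P" for P
  proof -
    obtain t where t: "P = B + t *\<^sub>R (C - B)" using Q by (auto simp: affine_hull_2_alt)
    have "t * ((C - B) \<bullet> (C - B)) - (A - B) \<bullet> (C - B) = 0" using Q unfolding t q by blast
    then have "t = ?t" using n by (simp add: eq_divide_eq)
    then show ?thesis using t by simp
  qed
  ultimately have "\<exists>!P. ?Q P" by (rule ex1I)
  then have "?Q (altitude_foot A B C)" unfolding altitude_foot_def by (rule theI')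
  then show "altitude_foot A B C \<in> affine hull {B, C}" "(altitude_foot A B C - A) \<bullet> (C - B) = 0"
    by blast+
qed

text \<open>The midpoints of \<open>HA\<close> and \<open>BC\<close> are antipodal on the nine-point circle, and the foot sees
  them under a right angle.\<close>

lemma altitude_foot_on_sphere:
  fixes A B C O' :: plane
  assumes "B \<noteq> C" "dist O' A = 2 * r" "dist O' B = 2 * r" "dist O' C = 2 * r"
  shows "altitude_foot A B C \<in> sphere ((1/2) *\<^sub>R (A + B + C - O')) r"
proof -
  define P where "P = altitude_foot A B C"
  define N where "N = (1/2) *\<^sub>R (A + B + C - O')"
  \<comment> \<open>\<open>N + w\<close> is the midpoint of \<open>HA\<close> and
    \<open>N - w\<close> the midpoint of \<open>BC\<close>.\<close>
  define w where "w = (1/2) *\<^sub>R (A - O')"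
  have nw: "norm w = r" using assms(2) unfolding w_def dist_norm by (simp add: norm_minus_commute)
  obtain t where t: "P = B + t *\<^sub>R (C - B)"
    using altitude_foot(1)[OF assms(1)] unfolding P_def by (auto simp: affine_hull_2_alt)
  have perp: "(P - A) \<bullet> (C - B) = 0" using altitude_foot(2)[OF assms(1)] unfolding P_def .
  have "norm (C - O') = norm (B - O')" using assms(3,4) by (simp add: dist_norm norm_minus_commute)
  then have "(C - O') \<bullet> (C - O') = (B - O') \<bullet> (B - O')" by (simp only: norm_eq)
  then have h: "((1/2) *\<^sub>R (B + C - 2 *\<^sub>R O')) \<bullet> (C - B) = 0" by (simp add: algebra_simps inner_commute)
  have "N + w = A + (1/2) *\<^sub>R (B + C - 2 *\<^sub>R O')"
    unfolding N_def w_def by (simp add: vec_eq_iff field_simps)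
  then have 1: "(P - (N + w)) \<bullet> (C - B) = 0" using perp h by (simp only: inner_diff_left inner_add_left)
  have 2: "P - (N - w) = (t - 1/2) *\<^sub>R (C - B)"
    unfolding t N_def w_def by (simp add: vec_eq_iff field_simps)
  have "(P - (N + w)) \<bullet> (P - (N - w)) = 0" unfolding 2 using 1 by simp
  then have "(P - N) \<bullet> (P - N) = w \<bullet> w" by (simp add: algebra_simps inner_commute)
  then have "norm (P - N) = r" unfolding nw[symmetric] by (simp add: norm_eq)
  then show ?thesis by (simp add: P_def N_def dist_norm norm_minus_commute)
qed

text \<open>Equating squared distances cancels the quadratic term in the center and leaves linear
  conditions along \<open>Q - P\<close> and \<open>R - P\<close>, the same for both centers.\<close>

lemma sphere_through_three_points:
  fixes P Q R :: plane
  assumes "\<not> collinear {P, Q, R}" "{P, Q, R} \<subseteq> sphere N r" "{P, Q, R} \<subseteq> sphere N' r'"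
  shows "N = N'" "r = r'"
proof -
  have eq: "2 * (N \<bullet> (X - P)) = X \<bullet> X - P \<bullet> P" if "dist N X = s" "dist N P = s" for N X :: plane and s
  proof -
    have "norm (N - X) = norm (N - P)" using that by (simp add: dist_norm)
    then have "(N - X) \<bullet> (N - X) = (N - P) \<bullet> (N - P)" by (simp only: norm_eq)
    then show ?thesis by (simp add: algebra_simps inner_commute)
  qed
  have "(N - N') \<bullet> (Q - P) = 0" "(N - N') \<bullet> (R - P) = 0"
    using eq[of N Q r] eq[of N' Q r'] eq[of N R r] eq[of N' R r'] assms(2,3)
    by (simp_all add: inner_diff_left)
  then have "N - N' = 0" by (rule orthogonal_to_two_directions[OF assms(1)])
  then show "N = N'" by simp
  then show "r = r'" using assms(2,3) by simp
qed

text \<open>The center is the midpoint of the circumcenter \<open>O'\<close> and the orthocenter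
  \<open>A + B + C - 2 *\<^sub>R O'\<close>; the radius is half the circumradius
  \<open>2 * r\<close>.\<close>

lemma nine_point_circle_eq:
  fixes A B C O' :: plane
  assumes nc: "\<not> collinear {A, B, C}" and "r > 0"
    and d: "dist O' A = 2 * r" "dist O' B = 2 * r" "dist O' C = 2 * r"
  shows "nine_point_circle A B C = sphere ((1/2) *\<^sub>R (A + B + C - O')) r"
  unfolding nine_point_circle_def
proof (rule the_equality)
  let ?N = "(1/2) *\<^sub>R (A + B + C - O')"
  have ne: "A \<noteq> B" "B \<noteq> C" "A \<noteq> C" using nc by (auto simp: insert_commute)
  have half: "dist O' X / 2 = norm ((1/2) *\<^sub>R (X - O'))" "dist O' X / 2 = norm ((1/2) *\<^sub>R (O' - X))" for X
    by (simp_all add: dist_norm norm_minus_commute)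
  have m: "?N - midpoint B C = (1/2) *\<^sub>R (A - O')" "?N - midpoint A C = (1/2) *\<^sub>R (B - O')"
    "?N - midpoint A B = (1/2) *\<^sub>R (C - O')"
    by (simp_all add: midpoint_def vec_eq_iff field_simps)
  have sm: "{midpoint B C, midpoint A C, midpoint A B} \<subseteq> sphere ?N r"
    unfolding insert_subset mem_sphere dist_norm[of ?N] m half(1)[symmetric] d by simp
  have H: "orthocenter A B C = A + B + C - 2 *\<^sub>R O'" by (rule orthocenter_eq[OF nc d])
  have h: "?N - midpoint (orthocenter A B C) X = (1/2) *\<^sub>R (O' - X)" for X
    unfolding H by (simp add: midpoint_def vec_eq_iff field_simps)
  have sh: "{midpoint (orthocenter A B C) A, midpoint (orthocenter A B C) B,
      midpoint (orthocenter A B C) C} \<subseteq> sphere ?N r"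
    unfolding insert_subset mem_sphere dist_norm[of ?N] h half(2)[symmetric] d by simp
  have p: "B + A + C = A + B + C" "C + A + B = A + B + C" by simp_all
  have sf: "{altitude_foot A B C, altitude_foot B A C, altitude_foot C A B} \<subseteq> sphere ?N r"
    using altitude_foot_on_sphere[OF ne(2) d] altitude_foot_on_sphere[OF ne(3) d(2,1,3)]
      altitude_foot_on_sphere[OF ne(1) d(3,1,2)] unfolding p by blast
  show "is_circle (sphere ?N r) \<and>
     {midpoint B C, midpoint A C, midpoint A B} \<subseteq> sphere ?N r \<and>
     {altitude_foot A B C, altitude_foot B A C, altitude_foot C A B} \<subseteq> sphere ?N r \<and>
     {midpoint (orthocenter A B C) A, midpoint (orthocenter A B C) B,
      midpoint (orthocenter A B C) C} \<subseteq> sphere ?N r"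
    using sm sf sh \<open>r > 0\<close> unfolding is_circle_def by metis
  fix S
  assume S: "is_circle S \<and> {midpoint B C, midpoint A C, midpoint A B} \<subseteq> S \<and>
     {altitude_foot A B C, altitude_foot B A C, altitude_foot C A B} \<subseteq> S \<and>
     {midpoint (orthocenter A B C) A, midpoint (orthocenter A B C) B,
      midpoint (orthocenter A B C) C} \<subseteq> S"
  then obtain Q s where Q: "S = sphere Q s" unfolding is_circle_def by metis
  \<comment> \<open>The medial triangle is nondegenerate, so its vertices determine the
    circle.\<close>
  have "\<not> collinear {midpoint B C, midpoint A C, midpoint A B}"
    using nc unfolding collinear_cross_iff midpoint_def by (simp add: field_simps)
  from sphere_through_three_points[OF this _ sm] S
  show "S = sphere ?N r" unfolding Q by metis
qed

text \<open>With side lengths \<open>a = y + z\<close> etc. and area \<open>S\<close> this is \<open>a\<^sup>2 (b\<^sup>2 + c\<^sup>2 - a\<^sup>2) / (16 S\<^sup>2)\<close>.\<close>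

definition circumcenter_weight :: "real \<Rightarrow> real \<Rightarrow> real \<Rightarrow> real" where
  "circumcenter_weight x y z =
     (y + z)\<^sup>2 * (x * (x + y + z) - y * z) / (8 * x * y * z * (x + y + z))"

definition circumcenter_pt :: "plane \<Rightarrow> plane \<Rightarrow> plane \<Rightarrow> real \<Rightarrow> real \<Rightarrow> real \<Rightarrow> plane" where
  "circumcenter_pt A B C x y z = bary A B C (circumcenter_weight x y z)
     (circumcenter_weight y z x) (circumcenter_weight z x y)"

text \<open>The quotient \<open>2r/R\<close> of the radii of the incircle and the nine-point circle.\<close>

definition ratio :: "real \<Rightarrow> real \<Rightarrow> real \<Rightarrow> real" where
  "ratio x y z = 8 * x * y * z / ((x + y) * (y + z) * (z + x))"

lemma circumcenter_weight_commute: "circumcenter_weight x z y = circumcenter_weight x y z"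
  by (simp add: circumcenter_weight_def ac_simps)

lemma circumcenter_pt_perm:
  "circumcenter_pt C A B z x y = circumcenter_pt A B C x y z"
  "circumcenter_pt B A C y x z = circumcenter_pt A B C x y z"
  using circumcenter_weight_commute[of x y z] circumcenter_weight_commute[of y z x]
    circumcenter_weight_commute[of z x y]
  by (simp_all add: circumcenter_pt_def bary_def ac_simps)

lemma ratio_perm: "ratio z x y = ratio x y z" "ratio y x z = ratio x y z"
  by (simp_all add: ratio_def ac_simps)

section \<open>Circumradius, homothetic contact points and Feuerbach's relation in barycentric
  coordinates\<close>

context ravi_triangle
begin

lemma ratio_pos: "ratio x y z > 0"
  using pos by (simp add: ratio_def)

lemma circumcenter_weight_sum:
  "circumcenter_weight x y z + circumcenter_weight y z x + circumcenter_weight z x y = 1"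
  unfolding circumcenter_weight_def using nonzero by (simp add: divide_simps) algebra

lemma dist_circumcenter:
  "dist (circumcenter_pt A B C x y z) A = 2 * (inradius x y z / ratio x y z)"
proof -
  let ?p = "circumcenter_weight x y z - 1"
  let ?q = "circumcenter_weight y z x"
  let ?r = "circumcenter_weight z x y"
  have d: "circumcenter_pt A B C x y z - A = bary A B C ?p ?q ?r"
    unfolding circumcenter_pt_def by (simp add: bary_def algebra_simps)
  have s: "?p + ?q + ?r = 0" using circumcenter_weight_sum by simp
  \<comment> \<open>Replaces the shifted weight, so that the identity below contains only the two
    plain weights.\<close>
  have p: "?p = - ?q - ?r" using s by simp
  have "(norm (bary A B C ?p ?q ?r))\<^sup>2 = (2 / ratio x y z)\<^sup>2 * (x * y * z / (x + y + z))"
    unfolding norm_bary[OF s] unfolding p circumcenter_weight_def ratio_def using nonzero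
    by (simp add: divide_simps) algebra
  also have "\<dots> = (2 * (inradius x y z / ratio x y z))\<^sup>2"
    by (simp add: power_mult_distrib power_divide inradius_sq)
  finally have "norm (bary A B C ?p ?q ?r) = 2 * (inradius x y z / ratio x y z)"
    using inradius_pos ratio_pos by (simp add: power2_eq_iff_nonneg)
  then show ?thesis unfolding dist_norm d .
qed

text \<open>The heart of the computation: \<open>D - I\<close> is \<open>ratio x y z\<close> times
  \<open>K M - N\<close>, with \<open>M\<close> the midpoint of \<open>B'C'\<close>. The difference
  in parentheses equals \<open>K M - N\<close>.\<close>

lemma contact_pt_homothetic_image:
  "contact_pt B C y z - incenter_pt A B C x y z =
    ratio x y z *\<^sub>R ((1/2) *\<^sub>R circumcenter_pt A B C x y z
      - (1/4) *\<^sub>R (excenter_pt B A C y x z + excenter_pt C A B z x y))"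
proof -
  \<comment> \<open>Each weight of the vector on the right is \<open>?c n\<close>, and the matching
    weight on the left is \<open>n / (2 * (x + y + z) * (y + z))\<close> with the same numerator
    \<open>n\<close>. Multiplication by \<open>ratio x y z\<close> turns the former into the
    latter.\<close>
  let ?c = "\<lambda>n. ((x + y) * (z + x) * n) / (16 * x * y * z * (x + y + z))"
  have "excenter_pt B A C y x z = bary A B C ((z + y) / (2 * y)) (- (x + z) / (2 * y)) ((y + x) / (2 * y))"
    "excenter_pt C A B z x y = bary A B C ((y + z) / (2 * z)) ((z + x) / (2 * z)) (- (x + y) / (2 * z))"
    unfolding excenter_pt_def bary_def by simp_all
  moreover have "1/2 * circumcenter_weight x y z - 1/4 * ((z + y) / (2 * y) + (y + z) / (2 * z)) =
      ?c (- ((y + z)\<^sup>2))"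
    unfolding circumcenter_weight_def using nonzero by (simp add: divide_simps) algebra
  moreover have
    "1/2 * circumcenter_weight y z x - 1/4 * (- (x + z) / (2 * y) + (z + x) / (2 * z)) =
      ?c (2 * (x + y + z) * z - (z + x) * (y + z))"
    unfolding circumcenter_weight_def using nonzero by (simp add: divide_simps) algebra
  moreover have
    "1/2 * circumcenter_weight z x y - 1/4 * ((y + x) / (2 * y) + - (x + y) / (2 * z)) =
      ?c (2 * (x + y + z) * y - (x + y) * (y + z))"
    unfolding circumcenter_weight_def using nonzero by (simp add: divide_simps) algebra
  moreover have
    "0 - (y + z) / (2 * (x + y + z)) = - ((y + z)\<^sup>2) / (2 * (x + y + z) * (y + z))"
    using nonzero by (simp add: divide_simps) algebra
  moreover have
    "z / (y + z) - (z + x) / (2 * (x + y + z)) =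
      (2 * (x + y + z) * z - (z + x) * (y + z)) / (2 * (x + y + z) * (y + z))"
    "y / (y + z) - (x + y) / (2 * (x + y + z)) =
      (2 * (x + y + z) * y - (x + y) * (y + z)) / (2 * (x + y + z) * (y + z))"
    using nonzero by (simp_all add: divide_simps)
  moreover have "n / (2 * (x + y + z) * (y + z)) = ratio x y z * ?c n" for n
    unfolding ratio_def using nonzero by (simp add: divide_simps)
  ultimately show ?thesis
    unfolding contact_pt_bary incenter_pt_def circumcenter_pt_def
    by (simp only: bary_add bary_scale bary_diff)
qed

definition nine_center :: plane where
  "nine_center = (1/2) *\<^sub>R (A + B + C - circumcenter_pt A B C x y z)"

text \<open>Feuerbach's relation \<open>IN = \<bar>R/2 - r\<bar>\<close>; here \<open>inradius / ratio\<close> is \<open>R/2\<close>.\<close>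

lemma dist_incenter_nine_center_sq:
  "(norm (incenter_pt A B C x y z - nine_center))\<^sup>2 =
    (inradius x y z / ratio x y z)\<^sup>2 * (1 - ratio x y z)\<^sup>2"
proof -
  let ?k = "1 / (16 * x * y * z * (x + y + z))"
  \<comment> \<open>The numerators of the weights of \<open>I - N\<close> over the common
    denominator in \<open>?k\<close>; the other two arise by cyclic rotation.\<close>
  define n where "n x y z = (y + z)\<^sup>2 * (x * (x + y + z) - y * z) - 8 * x\<^sup>2 * y * z" for x y z :: real
  have w1: "(y + z) / (2 * (x + y + z)) - 1/2 * (1 - circumcenter_weight x y z) = ?k * n x y z"
    unfolding circumcenter_weight_def n_def using nonzero by (simp add: divide_simps) algebra
  have w2: "(z + x) / (2 * (x + y + z)) - 1/2 * (1 - circumcenter_weight y z x) = ?k * n y z x"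
    unfolding circumcenter_weight_def n_def using nonzero by (simp add: divide_simps) algebra
  have w3: "(x + y) / (2 * (x + y + z)) - 1/2 * (1 - circumcenter_weight z x y) = ?k * n z x y"
    unfolding circumcenter_weight_def n_def using nonzero by (simp add: divide_simps) algebra
  have "incenter_pt A B C x y z - nine_center = bary A B C
     ((y + z) / (2 * (x + y + z)) - 1/2 * (1 - circumcenter_weight x y z))
     ((z + x) / (2 * (x + y + z)) - 1/2 * (1 - circumcenter_weight y z x))
     ((x + y) / (2 * (x + y + z)) - 1/2 * (1 - circumcenter_weight z x y))"
    unfolding incenter_pt_def nine_center_def circumcenter_pt_def
    by (simp add: bary_def algebra_simps)
  then have d: "incenter_pt A B C x y z - nine_center = ?k *\<^sub>R bary A B C (n x y z) (n y z x) (n z x y)"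
    unfolding w1 w2 w3 bary_scale .
  have s: "n x y z + n y z x + n z x y = 0" unfolding n_def by algebra
  have "(norm (bary A B C (n x y z) (n y z x) (n z x y)))\<^sup>2 =
      4 * x * y * z * (x + y + z) * ((x + y) * (y + z) * (z + x) - 8 * x * y * z)\<^sup>2"
    unfolding norm_bary[OF s] unfolding n_def by algebra
  moreover have "?k\<^sup>2 * (4 * x * y * z * (x + y + z) * ((x + y) * (y + z) * (z + x) - 8 * x * y * z)\<^sup>2)
      = (x * y * z / (x + y + z)) / (ratio x y z)\<^sup>2 * (1 - ratio x y z)\<^sup>2"
  proof -
    \<comment> \<open>Treating the product and the semiperimeter as atoms keeps the cleared
      denominators small.\<close>
    define P where "P = (x + y) * (y + z) * (z + x)"
    define s where "s = x + y + z"
    have "P \<noteq> 0" "s \<noteq> 0" using nonzero by (auto simp: P_def s_def)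
    then show ?thesis unfolding ratio_def P_def[symmetric] s_def[symmetric] using nonzero
      by (simp add: divide_simps) algebra
  qed
  ultimately show ?thesis unfolding d by (simp add: power_mult_distrib power_divide inradius_sq)
qed

end

section \<open>The homothety\<close>

context ravi_triangle
begin

lemma nine_point_circle: "nine_point_circle A B C = sphere nine_center (inradius x y z / ratio x y z)"
proof -
  interpret s: ravi_triangle B A C y x z by (rule permuted(2))
  interpret q: ravi_triangle C A B z x y by (rule permuted(1))
  have d: "dist (circumcenter_pt A B C x y z) B = 2 * (inradius x y z / ratio x y z)"
    "dist (circumcenter_pt A B C x y z) C = 2 * (inradius x y z / ratio x y z)"
    using s.dist_circumcenter q.dist_circumcenter
    unfolding circumcenter_pt_perm(2)[of B A C y x z] inradius_perm(2)[of y x z] ratio_perm(2)[of y x z]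
      circumcenter_pt_perm(1)[of C A B z x y] inradius_perm(1)[of z x y] ratio_perm(1)[of z x y] .
  show ?thesis unfolding nine_center_def
    using inradius_pos ratio_pos
    by (intro nine_point_circle_eq[OF noncollinear _ dist_circumcenter d]) simp
qed

text \<open>\<open>B'C'\<close> is the external bisector at \<open>A\<close>; in this combination
  the weights of \<open>B\<close> and \<open>C\<close> cancel.\<close>

lemma vertex_between_excenters: "A \<in> affine hull {excenter_pt B A C y x z, excenter_pt C A B z x y}"
proof -
  have "(y / (y + z)) *\<^sub>R excenter_pt B A C y x z + (z / (y + z)) *\<^sub>R excenter_pt C A B z x y
    = bary A B C (y / (y + z) * ((z + y) / (2 * y)) + z / (y + z) * ((y + z) / (2 * z)))
       (y / (y + z) * (- (x + z) / (2 * y)) + z / (y + z) * ((z + x) / (2 * z)))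
       (y / (y + z) * ((y + x) / (2 * y)) + z / (y + z) * (- (x + y) / (2 * z)))"
    unfolding excenter_pt_def bary_def by (simp add: algebra_simps)
  also have "\<dots> = bary A B C 1 0 0"
    using nonzero by (intro arg_cong3[where f = "bary A B C"]) (simp_all add: divide_simps)
  finally have "A = (y / (y + z)) *\<^sub>R excenter_pt B A C y x z + (z / (y + z)) *\<^sub>R excenter_pt C A B z x y"
    by (simp add: bary_vertices)
  moreover have "y / (y + z) + z / (y + z) = 1" using nonzero by (simp add: add_divide_distrib[symmetric])
  ultimately show ?thesis unfolding affine_hull_2 by blast
qed

text \<open>Each vertex lies on a line through two excenters, so collinear excenters would make
  \<open>A\<close>, \<open>B\<close>, \<open>C\<close> collinear.\<close>

lemma excenters_noncollinear:
  "\<not> collinear {excenter_pt A B C x y z, excenter_pt B A C y x z, excenter_pt C A B z x y}" (is "\<not> collinear ?E")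
proof
  assume c: "collinear ?E"
  interpret s: ravi_triangle B A C y x z by (rule permuted(2))
  interpret q: ravi_triangle C A B z x y by (rule permuted(1))
  have p: "excenter_pt C B A z y x = excenter_pt C A B z x y"
    "excenter_pt B C A y z x = excenter_pt B A C y x z" "excenter_pt A C B x z y = excenter_pt A B C x y z"
    using excenter_pt_perm by blast+
  have "A \<in> affine hull ?E"
    by (rule subsetD[OF hull_mono vertex_between_excenters]) blast
  moreover have "B \<in> affine hull ?E"
    by (rule subsetD[OF hull_mono s.vertex_between_excenters[unfolded p]]) blast
  moreover have "C \<in> affine hull ?E"
    by (rule subsetD[OF hull_mono q.vertex_between_excenters[unfolded p]]) blast
  ultimately have "{A, B, C} \<subseteq> affine hull ?E" by blast
  then have "collinear {A, B, C}"
    using c collinear_affine_hull_collinear collinear_subset by blast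
  then show False using noncollinear by simp
qed

text \<open>Given by the image of \<open>nine_center\<close> instead of a fixed point, which also
  covers ratio 1.\<close>

definition homothety_map :: "plane \<Rightarrow> plane" where
  "homothety_map X = incenter_pt A B C x y z + ratio x y z *\<^sub>R (X - nine_center)"

lemma contact_pt_eq_homothety_map:
  "contact_pt B C y z =
    homothety_map (complement_map A B C (midpoint (excenter_pt B A C y x z) (excenter_pt C A B z x y)))"
proof -
  \<comment> \<open>\<open>K\<close> sends the circumcenter to the nine-point center and halves
    vectors with reversed sign.\<close>
  have e: "complement_map A B C M - nine_center = (1/2) *\<^sub>R circumcenter_pt A B C x y z - (1/2) *\<^sub>R M" for M
    unfolding complement_map_def nine_center_def centroid_def by (simp add: vec_eq_iff field_simps)
  have "contact_pt B C y z = incenter_pt A B C x y z +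
      (contact_pt B C y z - incenter_pt A B C x y z)" by simp
  also have "\<dots> = homothety_map (complement_map A B C (midpoint (excenter_pt B A C y x z) (excenter_pt C A B z x y)))"
    unfolding contact_pt_homothetic_image homothety_map_def e midpoint_def by simp
  finally show ?thesis .
qed

lemma Phi_eq: "Phi A B C = homothety_map"
proof -
  interpret s: ravi_triangle B A C y x z by (rule permuted(2))
  interpret q: ravi_triangle C A B z x y by (rule permuted(1))
  let ?A = "excenter_pt A B C x y z" and ?B = "excenter_pt B A C y x z" and ?C = "excenter_pt C A B z x y"
  let ?K = "complement_map A B C"
  \<comment> \<open>The relabelled contexts describe the same excenters with the last two vertices
    exchanged.\<close>
  have p: "excenter_pt C B A z y x = ?C" "excenter_pt B C A y z x = ?B" "excenter_pt A C B x z y = ?A"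
    using excenter_pt_perm by blast+
  have nine: "s.nine_center = nine_center" "q.nine_center = nine_center"
    unfolding nine_center_def s.nine_center_def q.nine_center_def
      circumcenter_pt_perm(2)[of B A C y x z] circumcenter_pt_perm(1)[of C A B z x y]
    by (simp_all add: add.commute add.left_commute)
  have hm: "s.homothety_map = homothety_map" "q.homothety_map = homothety_map"
    unfolding fun_eq_iff homothety_map_def s.homothety_map_def q.homothety_map_def nine
      incenter_pt_perm(2)[of B A C y x z] ratio_perm(2)[of y x z]
      incenter_pt_perm(1)[of C A B z x y] ratio_perm(1)[of z x y] by simp_all
  have km: "complement_map B A C = ?K" "complement_map C A B = ?K"
    unfolding fun_eq_iff complement_map_def centroid_def
    by (simp_all add: add.commute add.left_commute)
  have K: "affine_map ?K"
  proof -
    have "?K = (\<lambda>X. centroid A B C + (- 1/2) *\<^sub>R (X - centroid A B C))"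
      by (simp add: fun_eq_iff complement_map_def)
    then show ?thesis by (simp only:) (rule affine_map_scale, simp)
  qed
  have h: "affine_map homothety_map"
  proof -
    have "homothety_map = (\<lambda>X. incenter_pt A B C x y z + ratio x y z *\<^sub>R (X - nine_center))"
      by (simp add: fun_eq_iff homothety_map_def)
    then show ?thesis using ratio_pos by (simp only:) (rule affine_map_scale, simp)
  qed
  \<comment> \<open>\<open>g\<close> will be the inverse of \<open>T2\<close>.\<close>
  obtain g where g: "affine_map g" "g A = ?A" "g B = ?B" "g C = ?C"
    by (rule affine_map_exists[OF noncollinear excenters_noncollinear])
  have ginj: "inj g" using affine_map_bij[OF g(1)] by (rule bij_is_inj)
  have T2: "T2 A B C = inv g"
    unfolding T2_def excenter_eq s.excenter_eq q.excenter_eq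
    by (rule triangle_map_eqI[OF excenters_noncollinear affine_map_inv[OF g(1)]])
       (simp_all add: ginj flip: g(2-4))
  \<comment> \<open>The midpoint as an affine combination with a trivial third term, so that
    preservation of combinations yields preservation of midpoints.\<close>
  have mid: "midpoint X Y = X + (1/2) *\<^sub>R (Y - X) + 0 *\<^sub>R (X - X)" for X Y :: plane
    by (simp add: midpoint_def vec_eq_iff field_simps)
  have gm: "g (midpoint X Y) = midpoint (g X) (g Y)" for X Y
    unfolding mid by (subst affine_map_combination[OF g(1)]) simp
  have Kv: "?K A = midpoint B C" "?K B = midpoint A C" "?K C = midpoint A B"
    by (simp_all add: complement_map_def centroid_def midpoint_def vec_eq_iff field_simps)
  have tp: "touch_point (incircle A B C) B C = contact_pt B C y z"
    "touch_point (incircle A B C) A C = contact_pt A C x z"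
    "touch_point (incircle A B C) A B = contact_pt A B x y"
    unfolding incircle_eq
    using touch_point_eqI[OF incircle_tangent]
      touch_point_eqI[OF s.incircle_tangent[unfolded incenter_pt_perm(2)[of B A C y x z] inradius_perm(2)[of y x z]]]
      touch_point_eqI[OF q.incircle_tangent[unfolded incenter_pt_perm(1)[of C A B z x y] inradius_perm(1)[of z x y]]]
    by blast+
  \<comment> \<open>At \<open>A\<close> the factors give in turn the midpoint of \<open>BC\<close>,
    the midpoint of \<open>B'C'\<close>, its complement, and \<open>D\<close>.\<close>
  have T1: "T1 A B C = homothety_map \<circ> ?K \<circ> g \<circ> ?K"
    unfolding T1_def tp
  proof (rule triangle_map_eqI[OF noncollinear])
    show "affine_map (homothety_map \<circ> ?K \<circ> g \<circ> ?K)"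
      by (intro affine_map_compose h K g)
    show "(homothety_map \<circ> ?K \<circ> g \<circ> ?K) A = contact_pt B C y z"
      unfolding comp_apply Kv gm g by (rule contact_pt_eq_homothety_map[symmetric])
    show "(homothety_map \<circ> ?K \<circ> g \<circ> ?K) B = contact_pt A C x z"
      using s.contact_pt_eq_homothety_map unfolding comp_apply Kv gm g p hm km by (rule sym)
    show "(homothety_map \<circ> ?K \<circ> g \<circ> ?K) C = contact_pt A B x y"
      using q.contact_pt_eq_homothety_map unfolding comp_apply Kv gm g p hm km by (rule sym)
  qed
  \<comment> \<open>With this factorization of \<open>T1\<close>, the composition defining
    \<open>Phi\<close> telescopes.\<close>
  have "?K (inv ?K X) = X" "g (inv g X) = X" for X
    using affine_map_bij[OF K] affine_map_bij[OF g(1)] by (simp_all add: bij_is_surj surj_f_inv_f)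
  then show ?thesis unfolding Phi_def T1 T2 by (simp add: fun_eq_iff)
qed

lemma ratio_eq_1_imp_equilateral:
  assumes "ratio x y z = 1"
  shows "equilateral A B C"
proof -
  have "8 * x * y * z = (x + y) * (y + z) * (z + x)"
    using assms nonzero unfolding ratio_def by (simp add: divide_simps)
  \<comment> \<open>The sum of squares is
    \<open>(x + y) * (y + z) * (z + x) - 8 * x * y * z\<close>.\<close>
  then have s: "x * (y - z)\<^sup>2 + y * (z - x)\<^sup>2 + z * (x - y)\<^sup>2 = 0" by algebra
  have "x * (y - z)\<^sup>2 \<ge> 0" "y * (z - x)\<^sup>2 \<ge> 0" "z * (x - y)\<^sup>2 \<ge> 0" using pos by simp_all
  then have "x * (y - z)\<^sup>2 = 0" "y * (z - x)\<^sup>2 = 0" using s by linarith+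
  then have "y = z" "z = x" using nonzero by simp_all
  then show ?thesis unfolding equilateral_def sides by (simp add: dist_commute[of A C] sides)
qed

end

section \<open>Homotheties and tangent circles\<close>

lemma homothety_center:
  fixes I N :: plane
  assumes "k \<noteq> 1"
  defines "h \<equiv> \<lambda>X. I + k *\<^sub>R (X - N)" and "Z \<equiv> N + (1 / (1 - k)) *\<^sub>R (I - N)"
  shows "h X - Z = k *\<^sub>R (X - Z)" "h X = X \<longleftrightarrow> X = Z"
proof -
  have k: "1 - k \<noteq> 0" using assms(1) by simp
  \<comment> \<open>This is the fixed-point equation \<open>Z = I + k *\<^sub>R (Z - N)\<close>
    solved for \<open>Z\<close>.\<close>
  have "(1 - k) *\<^sub>R Z = I - k *\<^sub>R N"
    unfolding Z_def using k by (simp add: scaleR_add_right) (simp add: algebra_simps)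
  then have hZ: "I = (1 - k) *\<^sub>R Z + k *\<^sub>R N" by simp
  show e: "h X - Z = k *\<^sub>R (X - Z)"
    unfolding h_def by (subst hZ) (simp add: algebra_simps)
  have "h X - X = (k - 1) *\<^sub>R (X - Z)" using e by (simp add: algebra_simps)
  then show "h X = X \<longleftrightarrow> X = Z" using assms(1)
    by (metis eq_iff_diff_eq_0 scaleR_eq_0_iff)
qed

lemma homothety_sphere_image:
  fixes I N :: plane
  assumes "k > 0"
  shows "(\<lambda>X. I + k *\<^sub>R (X - N)) ` sphere N r = sphere I (k * r)"
proof
  show "(\<lambda>X. I + k *\<^sub>R (X - N)) ` sphere N r \<subseteq> sphere I (k * r)"
    using assms by (auto simp: dist_norm norm_minus_commute)
  show "sphere I (k * r) \<subseteq> (\<lambda>X. I + k *\<^sub>R (X - N)) ` sphere N r"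
  proof
    fix Y assume "Y \<in> sphere I (k * r)"
    then have "N + (1/k) *\<^sub>R (Y - I) \<in> sphere N r" using assms by (simp add: dist_norm norm_minus_commute)
    moreover have "Y = I + k *\<^sub>R (N + (1/k) *\<^sub>R (Y - I) - N)" using assms by simp
    ultimately show "Y \<in> (\<lambda>X. I + k *\<^sub>R (X - N)) ` sphere N r" by blast
  qed
qed

text \<open>The component \<open>w\<close> of \<open>u\<close> orthogonal to \<open>v\<close> moves
  \<open>X\<close> within the common set, so it is orthogonal to \<open>u\<close> as well and hence
  to itself.\<close>

lemma same_perpendicular_imp_parallel:
  fixes u v :: "'a::real_inner"
  assumes "{Y. (Y - X) \<bullet> u = 0} = {Y. (Y - X) \<bullet> v = 0}" "v \<noteq> 0"
  obtains t where "u = t *\<^sub>R v"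
proof -
  define t where "t = (u \<bullet> v) / (v \<bullet> v)"
  define w where "w = u - t *\<^sub>R v"
  have wv: "w \<bullet> v = 0" using assms(2) by (simp add: w_def t_def inner_diff_left)
  then have "X + w \<in> {Y. (Y - X) \<bullet> v = 0}" by simp
  then have "w \<bullet> u = 0" unfolding assms(1)[symmetric] by simp
  then have "w \<bullet> w = 0" using wv by (simp add: w_def inner_diff_right)
  then have "u = t *\<^sub>R v" by (simp add: w_def)
  then show ?thesis by (rule that)
qed

text \<open>The assumption on the distance of the centers says that it is the difference of the radii.\<close>

lemma spheres_tangent_at_iff:
  fixes I N :: plane
  assumes k: "k > 0" "k \<noteq> 1" and r: "r > 0" and d: "(norm (I - N))\<^sup>2 = r\<^sup>2 * (1 - k)\<^sup>2"
  shows "circles_tangent_at (sphere I (k * r)) (sphere N r) X \<longleftrightarrow> X = N + (1 / (1 - k)) *\<^sub>R (I - N)"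
    and "N + (1 / (1 - k)) *\<^sub>R (I - N) \<in> sphere N r"
proof -
  let ?Z = "N + (1 / (1 - k)) *\<^sub>R (I - N)"
  have fix': "I + k *\<^sub>R (X - N) = X \<longleftrightarrow> X = ?Z" for X using homothety_center(2)[OF k(2)] .
  have "(norm (?Z - N))\<^sup>2 = r\<^sup>2"
    using k(2) d by (simp add: power_mult_distrib power_divide divide_simps)
  then have dZ: "norm (?Z - N) = r" using r by (simp add: power2_eq_iff_nonneg)
  then show "?Z \<in> sphere N r" by (simp add: dist_norm norm_minus_commute)
  have kr: "k * r > 0" using k r by simp
  have "circles_tangent_at (sphere I (k * r)) (sphere N r) X \<longleftrightarrow> dist I X = k * r \<and> dist N X = r \<and>
      {Y. (Y - X) \<bullet> (X - I) = 0} = {Y. (Y - X) \<bullet> (X - N) = 0}"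
    unfolding circles_tangent_at_def tangent_at_sphere_iff[OF kr] tangent_at_sphere_iff[OF r] by auto
  also have "\<dots> \<longleftrightarrow> X = ?Z"
  proof
    assume X: "dist I X = k * r \<and> dist N X = r \<and>
      {Y. (Y - X) \<bullet> (X - I) = 0} = {Y. (Y - X) \<bullet> (X - N) = 0}"
    then have n: "norm (X - I) = k * r" "norm (X - N) = r" by (simp_all add: dist_norm norm_minus_commute)
    then have "X - N \<noteq> 0" using r by auto
    then obtain t where t: "X - I = t *\<^sub>R (X - N)"
      using same_perpendicular_imp_parallel[of X "X - I" "X - N"] X by blast
    \<comment> \<open>A common tangent makes the radii at \<open>X\<close> parallel; their lengths
      leave only the sign of \<open>t\<close> open.\<close>
    have "\<bar>t\<bar> * r = k * r" using n unfolding t by simp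
    then have "t = k \<or> t = - k" using r by auto
    then show "X = ?Z"
    proof
      assume "t = k"
      then have "I + k *\<^sub>R (X - N) = X" using t by (metis add.commute diff_add_cancel)
      then show ?thesis using fix' by blast
    next
      \<comment> \<open>External tangency: the centers would be \<open>(1 + k) * r\<close> apart,
        against the assumed distance.\<close>
      assume "t = - k"
      then have "I - N = (1 + k) *\<^sub>R (X - N)" using t by (simp add: algebra_simps)
      then have "(norm (I - N))\<^sup>2 = (1 + k)\<^sup>2 * r\<^sup>2" using n by (simp add: power_mult_distrib)
      then have "(1 + k)\<^sup>2 = (1 - k)\<^sup>2" using d r by simp
      then have "k = 0" by algebra
      then show ?thesis using k by simp
    qed
  next
    assume X: "X = ?Z"
    then have e: "X - I = k *\<^sub>R (X - N)" using fix'[of X] by (metis add_diff_cancel_left')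
    have n: "norm (X - N) = r" using dZ X by simp
    then have "dist I X = k * r" "dist N X = r"
      using arg_cong[OF e, of norm] k by (simp_all add: dist_norm norm_minus_commute)
    then show "dist I X = k * r \<and> dist N X = r \<and>
      {Y. (Y - X) \<bullet> (X - I) = 0} = {Y. (Y - X) \<bullet> (X - N) = 0}"
      unfolding e using k by simp
  qed
  finally show "circles_tangent_at (sphere I (k * r)) (sphere N r) X \<longleftrightarrow> X = ?Z" .
qed

lemma ravi_triangle_exists:
  assumes "\<not> collinear {A, B, C}"
  obtains x y z where "ravi_triangle A B C x y z"
proof
  have "\<not> collinear {B, C, A}" "\<not> collinear {C, A, B}" using assms by (simp_all add: insert_commute)
  then have "dist B C < dist A B + dist A C" "dist C A < dist B C + dist B A" "dist A B < dist C A + dist C B"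
    using assms strict_triangle_inequality by blast+
  \<comment> \<open>The tangent lengths are the semiperimeter minus the opposite sides.\<close>
  then show "ravi_triangle A B C ((dist C A + dist A B - dist B C) / 2)
    ((dist A B + dist B C - dist C A) / 2) ((dist B C + dist C A - dist A B) / 2)"
    using assms by unfold_locales (simp_all add: dist_commute field_simps)
qed

theorem mainTheorem1:
  fixes A B C :: plane
  assumes "\<not> collinear {A, B, C}"
  shows "Phi A B C ` nine_point_circle A B C = incircle A B C \<and>
    (\<exists>Z. Phi A B C Z = Z \<and> Z \<in> nine_point_circle A B C) \<and>
    homothety (Phi A B C) \<and>
    (\<not> equilateral A B C \<longrightarrow>
      (\<exists>Z. {X. Phi A B C X = X} = {Z} \<and>
           (\<exists>k. homothety_about Z k (Phi A B C)) \<and>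
           {X. circles_tangent_at (incircle A B C) (nine_point_circle A B C) X} = {Z}))"
proof -
  obtain x y z where "ravi_triangle A B C x y z" by (rule ravi_triangle_exists[OF assms])
  then interpret ravi_triangle A B C x y z .
  define k where "k = ratio x y z"
  define r where "r = inradius x y z / k"
  define I where "I = incenter_pt A B C x y z"
  define N where "N = nine_center"
  define h where "h = (\<lambda>X. I + k *\<^sub>R (X - N))"
  have k: "k > 0" using ratio_pos by (simp add: k_def)
  have r: "r > 0" "inradius x y z = k * r" using inradius_pos k by (simp_all add: r_def)
  have Phi: "Phi A B C = h" unfolding Phi_eq h_def by (simp add: fun_eq_iff homothety_map_def k_def I_def N_def)
  have N: "nine_point_circle A B C = sphere N r" unfolding nine_point_circle N_def r_def k_def ..
  have I: "incircle A B C = sphere I (k * r)" unfolding incircle_eq I_def r(2) ..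
  have d: "(norm (I - N))\<^sup>2 = r\<^sup>2 * (1 - k)\<^sup>2"
    using dist_incenter_nine_center_sq unfolding I_def N_def r_def k_def .
  have image: "h ` sphere N r = sphere I (k * r)" unfolding h_def by (rule homothety_sphere_image[OF k])
  show ?thesis
  proof (cases "k = 1")
    case True
    \<comment> \<open>Ratio 1 makes the centers coincide, so \<open>h\<close> is the identity: every
      point of the nine-point circle is fixed and the last claim is vacuous.\<close>
    then have "I = N" using d by simp
    then have id: "h X = X" for X by (simp add: h_def True)
    have eq: "equilateral A B C" using ratio_eq_1_imp_equilateral True by (simp add: k_def)
    obtain Z where "Z \<in> sphere N r" using r(1) by (metis all_not_in_conv less_imp_le not_less sphere_eq_empty)
    moreover have "homothety h" unfolding homothety_def homothety_about_def by (intro exI[of _ N] exI[of _ 1]) (simp add: id)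
    ultimately show ?thesis unfolding Phi N I using image id eq by blast
  next
    case False
    define Z where "Z = N + (1 / (1 - k)) *\<^sub>R (I - N)"
    have c: "h X - Z = k *\<^sub>R (X - Z)" "h X = X \<longleftrightarrow> X = Z" for X
      unfolding h_def Z_def by (rule homothety_center[OF False])+
    have ha: "homothety_about Z k h" unfolding homothety_about_def using c by blast
    \<comment> \<open>The fixed point of \<open>h\<close> is the only point of tangency, which
      identifies it as the Feuerbach point.\<close>
    have t: "circles_tangent_at (sphere I (k * r)) (sphere N r) X \<longleftrightarrow> X = Z" for X
      unfolding Z_def by (rule spheres_tangent_at_iff(1)[OF k False r(1) d])
    have ZN: "Z \<in> sphere N r"
      unfolding Z_def by (rule spheres_tangent_at_iff(2)[OF k False r(1) d])
    show ?thesis unfolding Phi N I t using image ha ZN by (auto simp: c homothety_def)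
  qed
qed

end
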